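(* Suppose $(c,\gamma)\in I$. Then: (i) If $c_3>\bar c_3(c_1,c_2)$, then $\gamma^-(c)<\gamma^+(c)$, and for any $\gamma^-(c)\le\gamma<\gamma'\le\gamma^+(c)$ we have $U^{c,\gamma}_\theta<U^{c,\gamma'}_\theta$ in $(-1,1)$. Moreover $$\{(x,y): -1<x<1,\ U^{c,\gamma^-(c)}_\theta(x)\le y\le U^{c,\gamma^+(c)}_\theta(x)\}=\bigcup_{\gamma\in[\gamma^-(c),\gamma^+(c)]}\{(x,U^{c,\gamma}_\theta(x)):-1<x<1\}.$$ (ii) $U^{c,\gamma}_\theta(-1)=\tau_2(c_1)$ if $\gamma=\gamma^+(c)$ and $=\tau_1(c_1)$ otherwise; $U^{c,\gamma}_\theta(1)=\tau_1'(c_2)$ if $\gamma=\gamma^-(c)$ and $=\tau_2'(c_2)$ otherwise.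
   Context: For $c=(c_1,c_2,c_3)\in\mathbb{R}^3$ let $P_c(x):=c_1(1-x)+c_2(1+x)+c_3(1-x^2)$ and consider the ODE $(1-x^2)U'+2xU+\frac12U^2=P_c(x)$ on $(-1,1)$. For $c_1,c_2\ge-1$ let $\bar c_3(c_1,c_2):=-\frac12(\sqrt{1+c_1}+\sqrt{1+c_2})(\sqrt{1+c_1}+\sqrt{1+c_2}+2)$ and $J:=\{c: c_1\ge-1,c_2\ge-1,c_3\ge\bar c_3(c_1,c_2)\}$. For $c\in J$ there are solutions $U^\pm_\theta(c)$ on $(-1,1)$ with $U^-_\theta(c)\le U\le U^+_\theta(c)$ for every solution $U$ on $(-1,1)$; set $\gamma^\pm(c):=U^\pm_\theta(c)(0)$ and $I:=\{(c,\gamma): c\in J,\ \gamma^-(c)\le\gamma\le\gamma^+(c)\}$. For $(c,\gamma)\in I$, $U^{c,\gamma}_\theta$ denotes the unique solution in $C^\infty(-1,1)\cap C^0[-1,1]$ with $U^{c,\gamma}_\theta(0)=\gamma$, and $U^{c,\gamma}_\theta(\pm1)$ denote its boundary values. Define $\tau_1(c_1):=2-2\sqrt{1+c_1}$, $\tau_2(c_1):=2+2\sqrt{1+c_1}$, $\tau_1'(c_2):=-2-2\sqrt{1+c_2}$, $\tau_2'(c_2):=-2+2\sqrt{1+c_2}$. *)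

theory Defs
  imports "HOL-Analysis.Analysis"
begin

definition Pc :: "real \<Rightarrow> real \<Rightarrow> real \<Rightarrow> real \<Rightarrow> real" where
  "Pc c1 c2 c3 x = c1 * (1 - x) + c2 * (1 + x) + c3 * (1 - x\<^sup>2)"

definition is_sol :: "real \<Rightarrow> real \<Rightarrow> real \<Rightarrow> (real \<Rightarrow> real) \<Rightarrow> bool" where
  "is_sol c1 c2 c3 U \<longleftrightarrow>
     (\<forall>x\<in>{-1<..<1}. \<exists>D. (U has_real_derivative D) (at x) \<and>
        (1 - x\<^sup>2) * D + 2 * x * U x + (1/2) * (U x)\<^sup>2 = Pc c1 c2 c3 x)"

definition smooth_on :: "real set \<Rightarrow> (real \<Rightarrow> real) \<Rightarrow> bool" where
  "smooth_on S f \<longleftrightarrow> (\<forall>n. \<forall>x\<in>S. ((deriv ^^ n) f) differentiable (at x))"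

definition c3bar :: "real \<Rightarrow> real \<Rightarrow> real" where
  "c3bar c1 c2 = - (1/2) * (sqrt (1 + c1) + sqrt (1 + c2)) * (sqrt (1 + c1) + sqrt (1 + c2) + 2)"

definition inJ :: "real \<Rightarrow> real \<Rightarrow> real \<Rightarrow> bool" where
  "inJ c1 c2 c3 \<longleftrightarrow> c1 \<ge> -1 \<and> c2 \<ge> -1 \<and> c3 \<ge> c3bar c1 c2"

definition gamma_plus :: "real \<Rightarrow> real \<Rightarrow> real \<Rightarrow> real" where
  "gamma_plus c1 c2 c3 = (THE g. \<exists>U. is_sol c1 c2 c3 U \<and> U 0 = g \<and>
      (\<forall>V. is_sol c1 c2 c3 V \<longrightarrow> (\<forall>x\<in>{-1<..<1}. V x \<le> U x)))"

definition gamma_minus :: "real \<Rightarrow> real \<Rightarrow> real \<Rightarrow> real" where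
  "gamma_minus c1 c2 c3 = (THE g. \<exists>U. is_sol c1 c2 c3 U \<and> U 0 = g \<and>
      (\<forall>V. is_sol c1 c2 c3 V \<longrightarrow> (\<forall>x\<in>{-1<..<1}. U x \<le> V x)))"

definition inI :: "real \<Rightarrow> real \<Rightarrow> real \<Rightarrow> real \<Rightarrow> bool" where
  "inI c1 c2 c3 g \<longleftrightarrow> inJ c1 c2 c3 \<and> gamma_minus c1 c2 c3 \<le> g \<and> g \<le> gamma_plus c1 c2 c3"

text \<open>U^{c,gamma}_theta: the unique solution in C^infinity(-1,1) \<inter> C^0[-1,1] with U(0)=gamma.
  It is pinned down as a function on [-1,1]; outside [-1,1] it is set to 0 by convention.\<close>
definition Ucg :: "real \<Rightarrow> real \<Rightarrow> real \<Rightarrow> real \<Rightarrow> real \<Rightarrow> real" where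
  "Ucg c1 c2 c3 g = (THE U. is_sol c1 c2 c3 U \<and> smooth_on {-1<..<1} U \<and>
      continuous_on {-1..1} U \<and> U 0 = g \<and> (\<forall>x. x \<notin> {-1..1} \<longrightarrow> U x = 0))"

definition tau1 :: "real \<Rightarrow> real" where "tau1 c1 = 2 - 2 * sqrt (1 + c1)"
definition tau2 :: "real \<Rightarrow> real" where "tau2 c1 = 2 + 2 * sqrt (1 + c1)"
definition tau1' :: "real \<Rightarrow> real" where "tau1' c2 = -2 - 2 * sqrt (1 + c2)"
definition tau2' :: "real \<Rightarrow> real" where "tau2' c2 = -2 + 2 * sqrt (1 + c2)"

end

theory Submission
  imports Defs "HOL-Real_Asymp.Real_Asymp"
begin

text \<open>
  The substitution U = 2(1 - x^2) \<phi>'/\<phi> turns the ODE into \<phi>'' = P / (2(1 - x^2)^2) \<phi>, whose positive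
  solutions on (-1,1) correspond to the solutions U. For c3 = c3bar there is the explicit solution
  \<phi>0 = (1+x)^(\<alpha>/2) (1-x)^(\<beta>/2) with \<alpha> = 1 + sqrt (1+c1) and \<beta> = 1 + sqrt (1+c2). In general put
  \<phi> = \<phi>0 w and t = (1+x)/2; then w solves the hypergeometric equation
  t(1-t) w'' + (\<alpha>(1-t) - \<beta>t) w' = \<kappa> w with \<kappa> = (c3 - c3bar)/2 \<ge> 0. Its power series w1 at t = 0
  has nonnegative coefficients, and by reflection there is a power series w2 at t = 1. The
  solutions w1 and w2 are principal at -1 and at 1 and yield the largest and the smallest U, and all
  solutions come from l w1 + (1-l) w2 with 0 \<le> l \<le> 1. For \<kappa> > 0 they are strictly increasing in l.
  The boundary values follow from an Abelian theorem for (1-t) w1'/w1 as t tends to 1.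
\<close>

section \<open>The hypergeometric series\<close>

text \<open>Comparing coefficients of t^n in the hypergeometric equation gives this recursion. The
  series is Gauss's 2F1(a, b; \<alpha>; t) with a + b = \<alpha> + \<beta> - 1 and a b = \<kappa>;
  the numerator stays unfactored because a and b can be complex.\<close>

fun hyp_coeff :: "real \<Rightarrow> real \<Rightarrow> real \<Rightarrow> nat \<Rightarrow> real" where
  "hyp_coeff \<alpha> \<beta> \<kappa> 0 = 1"
| "hyp_coeff \<alpha> \<beta> \<kappa> (Suc n) = hyp_coeff \<alpha> \<beta> \<kappa> n *
     ((real n)\<^sup>2 + (\<alpha> + \<beta> - 1) * real n + \<kappa>) / ((real n + 1) * (real n + \<alpha>))"

definition hyp_fun :: "real \<Rightarrow> real \<Rightarrow> real \<Rightarrow> real \<Rightarrow> real" where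
  "hyp_fun \<alpha> \<beta> \<kappa> t = (\<Sum>n. hyp_coeff \<alpha> \<beta> \<kappa> n * t ^ n)"

definition hyp_deriv :: "real \<Rightarrow> real \<Rightarrow> real \<Rightarrow> real \<Rightarrow> real" where
  "hyp_deriv \<alpha> \<beta> \<kappa> t = (\<Sum>n. diffs (hyp_coeff \<alpha> \<beta> \<kappa>) n * t ^ n)"

lemma hyp_coeff_nonneg:
  assumes "\<alpha> \<ge> 1" "\<beta> \<ge> 1" "\<kappa> \<ge> 0"
  shows "hyp_coeff \<alpha> \<beta> \<kappa> n \<ge> 0"
  using assms by (induction n) (auto intro!: divide_nonneg_nonneg mult_nonneg_nonneg add_nonneg_nonneg)

lemma hyp_coeff_rec:
  assumes "\<alpha> \<ge> 1"
  shows "(real n + 1) * (real n + \<alpha>) * hyp_coeff \<alpha> \<beta> \<kappa> (Suc n) =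
         hyp_coeff \<alpha> \<beta> \<kappa> n * ((real n)\<^sup>2 + (\<alpha> + \<beta> - 1) * real n + \<kappa>)"
proof -
  have "(real n + 1) * (real n + \<alpha>) \<noteq> 0" using assms by (simp add: add_nonneg_eq_0_iff)
  thus ?thesis by simp
qed

lemma hyp_coeff_ratio_tendsto:
  "(\<lambda>n. ((real n)\<^sup>2 + (\<alpha> + \<beta> - 1) * real n + \<kappa>) / ((real n + 1) * (real n + \<alpha>)))
     \<longlonglongrightarrow> 1"
  by real_asymp

lemma hyp_summable:
  fixes t :: real
  assumes "norm t < 1"
  shows "summable (\<lambda>n. hyp_coeff \<alpha> \<beta> \<kappa> n * t ^ n)"
proof -
  let ?r = "\<lambda>n. ((real n)\<^sup>2 + (\<alpha> + \<beta> - 1) * real n + \<kappa>) / ((real n + 1) * (real n + \<alpha>))"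
  obtain c where c: "\<bar>t\<bar> < c" "c < 1" using assms dense by auto
  have "(\<lambda>n. \<bar>?r n * t\<bar>) \<longlonglongrightarrow> \<bar>1 * t\<bar>"
    by (intro tendsto_intros hyp_coeff_ratio_tendsto)
  hence "eventually (\<lambda>n. \<bar>?r n * t\<bar> < c) sequentially"
    using c by (intro order_tendstoD) auto
  then obtain N where N: "\<And>n. n \<ge> N \<Longrightarrow> \<bar>?r n * t\<bar> < c"
    by (auto simp: eventually_sequentially)
  show ?thesis
  proof (rule summable_ratio_test[OF c(2)])
    fix n assume "n \<ge> N"
    have "norm (hyp_coeff \<alpha> \<beta> \<kappa> (Suc n) * t ^ Suc n)
      = \<bar>?r n * t\<bar> * norm (hyp_coeff \<alpha> \<beta> \<kappa> n * t ^ n)"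
      by (simp add: abs_mult)
    also have "\<dots> \<le> c * norm (hyp_coeff \<alpha> \<beta> \<kappa> n * t ^ n)"
      using N[OF \<open>n \<ge> N\<close>] by (intro mult_right_mono) auto
    finally show "norm (hyp_coeff \<alpha> \<beta> \<kappa> (Suc n) * t ^ Suc n) \<le> \<dots>" .
  qed
qed

lemma hyp_diffs_summable:
  fixes t :: real
  assumes "norm t < 1"
  shows "summable (\<lambda>n. diffs (hyp_coeff \<alpha> \<beta> \<kappa>) n * t ^ n)"
  by (rule termdiff_converges[OF assms]) (rule hyp_summable)

lemma hyp_fun_has_derivative:
  assumes "\<bar>t\<bar> < 1"
  shows "(hyp_fun \<alpha> \<beta> \<kappa> has_real_derivative hyp_deriv \<alpha> \<beta> \<kappa> t) (at t)"
  unfolding hyp_fun_def hyp_deriv_def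
  by (rule termdiffs_strong'[of 1]) (use assms hyp_summable in auto)

text \<open>The Euler operator t d/dt multiplies the n-th coefficient of a power series by
  n.\<close>

lemma theta_sums:
  fixes t :: real
  assumes "summable (\<lambda>n. diffs c n * t ^ n)"
  shows "(\<lambda>n. real n * c n * t ^ n) sums (t * (\<Sum>n. diffs c n * t ^ n))"
proof -
  have "(\<lambda>n. t * (real n * c n * t ^ (n - Suc 0))) sums (t * (\<Sum>n. diffs c n * t ^ n))"
    by (rule sums_mult[OF diffs_equiv[OF assms]])
  moreover have "t * (real n * c n * t ^ (n - Suc 0)) = real n * c n * t ^ n" for n
    by (cases n) auto
  ultimately show ?thesis by simp
qed

text \<open>Each term of the equation is expanded in powers t^n; the coefficients cancel by
  \<open>hyp_coeff_rec\<close>.\<close>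

lemma hyp_deriv_has_derivative:
  assumes t: "\<bar>t\<bar> < 1" and \<alpha>: "\<alpha> \<ge> 1"
  obtains D where "(hyp_deriv \<alpha> \<beta> \<kappa> has_real_derivative D) (at t)"
    "t * (1 - t) * D + (\<alpha> * (1 - t) - \<beta> * t) * hyp_deriv \<alpha> \<beta> \<kappa> t = \<kappa> * hyp_fun \<alpha> \<beta> \<kappa> t"
proof
  let ?a = "hyp_coeff \<alpha> \<beta> \<kappa>"
  define D where "D = (\<Sum>n. diffs (diffs ?a) n * t ^ n)"
  show "(hyp_deriv \<alpha> \<beta> \<kappa> has_real_derivative D) (at t)"
    unfolding hyp_deriv_def D_def
    by (rule termdiffs_strong'[of 1]) (use t hyp_diffs_summable in auto)
  have sm: "summable (\<lambda>n. diffs (diffs ?a) n * t ^ n)"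
    by (rule termdiff_converges[of _ 1]) (use t hyp_diffs_summable in auto)
  have 1: "(\<lambda>n. real n * diffs ?a n * t ^ n) sums (t * D)"
    unfolding D_def by (rule theta_sums[OF sm])
  from sums_mult[OF 1, of t]
  have "(\<lambda>n. real (Suc n) * (real (Suc n) - 1) * ?a (Suc n) * t ^ Suc n) sums (t * (t * D))"
    by (simp add: diffs_def algebra_simps)
  \<comment> \<open>An index shift: the series so far starts at exponent 1, and the added term at n
    = 0 vanishes through the factor \<open>real n\<close>.\<close>
  hence 2: "(\<lambda>n. real n * (real n - 1) * ?a n * t ^ n) sums (t * (t * D))"
    by (subst (asm) sums_Suc_iff) simp
  have 3: "(\<lambda>n. diffs ?a n * t ^ n) sums hyp_deriv \<alpha> \<beta> \<kappa> t"
    unfolding hyp_deriv_def by (rule summable_sums) (use t hyp_diffs_summable in auto)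
  have 4: "(\<lambda>n. real n * ?a n * t ^ n) sums (t * hyp_deriv \<alpha> \<beta> \<kappa> t)"
    unfolding hyp_deriv_def by (rule theta_sums) (use t hyp_diffs_summable in auto)
  have 5: "(\<lambda>n. ?a n * t ^ n) sums hyp_fun \<alpha> \<beta> \<kappa> t"
    unfolding hyp_fun_def by (rule summable_sums) (use t hyp_summable in auto)
  have "(\<lambda>n. real n * diffs ?a n * t ^ n - real n * (real n - 1) * ?a n * t ^ n
           + \<alpha> * (diffs ?a n * t ^ n) - (\<alpha> + \<beta>) * (real n * ?a n * t ^ n) - \<kappa> * (?a n * t ^ n))
        sums (t * D - t * (t * D) + \<alpha> * hyp_deriv \<alpha> \<beta> \<kappa> t
           - (\<alpha> + \<beta>) * (t * hyp_deriv \<alpha> \<beta> \<kappa> t) - \<kappa> * hyp_fun \<alpha> \<beta> \<kappa> t)"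
    by (intro sums_add sums_diff sums_mult 1 2 3 4 5)
  moreover have "real n * diffs ?a n * t ^ n - real n * (real n - 1) * ?a n * t ^ n
           + \<alpha> * (diffs ?a n * t ^ n) - (\<alpha> + \<beta>) * (real n * ?a n * t ^ n) - \<kappa> * (?a n * t ^ n) = 0" for n
  proof -
    have "real n * diffs ?a n * t ^ n - real n * (real n - 1) * ?a n * t ^ n
           + \<alpha> * (diffs ?a n * t ^ n) - (\<alpha> + \<beta>) * (real n * ?a n * t ^ n) - \<kappa> * (?a n * t ^ n) =
      ((real n + 1) * (real n + \<alpha>) * ?a (Suc n) - ?a n * ((real n)\<^sup>2 + (\<alpha> + \<beta> - 1) * real n + \<kappa>)) * t ^ n"
      unfolding diffs_def of_nat_Suc by (simp only: algebra_simps power2_eq_square)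
    also have "\<dots> = 0" by (simp only: hyp_coeff_rec[OF \<alpha>] diff_self mult_zero_left)
    finally show ?thesis .
  qed
  ultimately have "(\<lambda>n. 0) sums (t * D - t * (t * D) + \<alpha> * hyp_deriv \<alpha> \<beta> \<kappa> t
           - (\<alpha> + \<beta>) * (t * hyp_deriv \<alpha> \<beta> \<kappa> t) - \<kappa> * hyp_fun \<alpha> \<beta> \<kappa> t)"
    by simp
  hence "t * D - t * (t * D) + \<alpha> * hyp_deriv \<alpha> \<beta> \<kappa> t
           - (\<alpha> + \<beta>) * (t * hyp_deriv \<alpha> \<beta> \<kappa> t) - \<kappa> * hyp_fun \<alpha> \<beta> \<kappa> t = 0"
    by (metis sums_unique2 sums_zero)
  thus "t * (1 - t) * D + (\<alpha> * (1 - t) - \<beta> * t) * hyp_deriv \<alpha> \<beta> \<kappa> t = \<kappa> * hyp_fun \<alpha> \<beta> \<kappa> t"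
    by (simp add: algebra_simps)
qed

lemma hyp_fun_0: "hyp_fun \<alpha> \<beta> \<kappa> 0 = 1"
  by (simp add: hyp_fun_def powser_zero)

lemma hyp_deriv_nonneg:
  assumes "\<alpha> \<ge> 1" "\<beta> \<ge> 1" "\<kappa> \<ge> 0" "0 \<le> t" "t < 1"
  shows "hyp_deriv \<alpha> \<beta> \<kappa> t \<ge> 0"
  unfolding hyp_deriv_def using assms hyp_coeff_nonneg[OF assms(1-3)] hyp_diffs_summable[of t]
  by (intro suminf_nonneg) (auto simp: diffs_def simp del: hyp_coeff.simps)

lemma hyp_fun_mono:
  assumes "\<alpha> \<ge> 1" "\<beta> \<ge> 1" "\<kappa> \<ge> 0" "0 \<le> s" "s \<le> t" "t < 1"
  shows "hyp_fun \<alpha> \<beta> \<kappa> s \<le> hyp_fun \<alpha> \<beta> \<kappa> t"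
proof (rule DERIV_nonneg_imp_nondecreasing[OF assms(5)])
  fix x assume "s \<le> x" "x \<le> t"
  hence "0 \<le> x" "x < 1" using assms by auto
  thus "\<exists>y. (hyp_fun \<alpha> \<beta> \<kappa> has_real_derivative y) (at x) \<and> 0 \<le> y"
    using hyp_fun_has_derivative[of x] hyp_deriv_nonneg[OF assms(1-3)] by fastforce
qed

lemma hyp_fun_ge_1:
  assumes "\<alpha> \<ge> 1" "\<beta> \<ge> 1" "\<kappa> \<ge> 0" "0 \<le> t" "t < 1"
  shows "hyp_fun \<alpha> \<beta> \<kappa> t \<ge> 1"
  using hyp_fun_mono[OF assms(1-3) _ assms(4,5)] by (simp add: hyp_fun_0)

section \<open>Behaviour of the series as t tends to 1\<close>

lemma diffs_hyp_coeff_ge: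
  assumes "\<alpha> \<ge> 1" "\<beta> \<ge> 1" "\<kappa> \<ge> 0"
  shows "diffs (hyp_coeff \<alpha> \<beta> \<kappa>) n \<ge> \<kappa> / \<alpha>"
proof (induction n)
  case 0
  show ?case using assms by (simp add: diffs_def)
next
  case (Suc n)
  let ?a = "hyp_coeff \<alpha> \<beta> \<kappa>"
  let ?m = "real (Suc n)"
  \<comment> \<open>Here \<beta> \<ge> 1 enters: it makes the coefficients of the derivative
    nondecreasing, so all of them stay above the first one, \<kappa> / \<alpha>.\<close>
  have "?m * (?m + \<alpha>) \<le> ?m\<^sup>2 + (\<alpha> + \<beta> - 1) * ?m + \<kappa>"
  proof -
    have "?m\<^sup>2 + (\<alpha> + \<beta> - 1) * ?m + \<kappa> - ?m * (?m + \<alpha>) = (\<beta> - 1) * ?m + \<kappa>"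
      by (simp only: algebra_simps power2_eq_square)
    moreover have "(\<beta> - 1) * ?m + \<kappa> \<ge> 0" using assms by simp
    ultimately show ?thesis by linarith
  qed
  hence "?a (Suc n) * (?m * (?m + \<alpha>)) \<le> ?a (Suc n) * (?m\<^sup>2 + (\<alpha> + \<beta> - 1) * ?m + \<kappa>)"
    using hyp_coeff_nonneg[OF assms] by (intro mult_left_mono)
  also have "\<dots> = (?m + 1) * (?m + \<alpha>) * ?a (Suc (Suc n))"
    by (rule hyp_coeff_rec[OF assms(1), symmetric])
  finally have "(?m * ?a (Suc n)) * (?m + \<alpha>) \<le> ((?m + 1) * ?a (Suc (Suc n))) * (?m + \<alpha>)"
    by (simp only: ac_simps)
  moreover have "?m + \<alpha> > 0" using assms by simp
  ultimately have "?m * ?a (Suc n) \<le> (?m + 1) * ?a (Suc (Suc n))"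
    by (simp only: mult_le_cancel_right_pos)
  thus ?case using Suc unfolding diffs_def by (simp only: of_nat_Suc add.commute)
qed

text \<open>Comparison with \<kappa> / \<alpha> times the geometric series. The bound yields both
  the divergence at t = 1 and the strict monotonicity of the solution family.\<close>

lemma hyp_deriv_ge:
  assumes "\<alpha> \<ge> 1" "\<beta> \<ge> 1" "\<kappa> \<ge> 0" "0 \<le> t" "t < 1"
  shows "hyp_deriv \<alpha> \<beta> \<kappa> t \<ge> (\<kappa> / \<alpha>) / (1 - t)"
proof -
  have g: "(\<lambda>n. (\<kappa> / \<alpha>) * t ^ n) sums ((\<kappa> / \<alpha>) * (1 / (1 - t)))"
    using assms by (intro sums_mult geometric_sums) auto
  have "(\<Sum>n. (\<kappa> / \<alpha>) * t ^ n) \<le> hyp_deriv \<alpha> \<beta> \<kappa> t"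
    unfolding hyp_deriv_def using assms
    by (intro suminf_le hyp_diffs_summable sums_summable[OF g] mult_right_mono diffs_hyp_coeff_ge) auto
  thus ?thesis using sums_unique[OF g] by simp
qed

lemma hyp_fun_at_top:
  assumes "\<alpha> \<ge> 1" "\<beta> \<ge> 1" "\<kappa> > 0"
  shows "filterlim (hyp_fun \<alpha> \<beta> \<kappa>) at_top (at_left 1)"
proof (rule filterlim_at_top_mono)
  have "\<kappa> / \<alpha> > 0" using assms by simp
  thus "filterlim (\<lambda>t. 1 - (\<kappa> / \<alpha>) * ln (1 - t)) at_top (at_left 1)"
    by real_asymp
  have "1 - (\<kappa> / \<alpha>) * ln (1 - t) \<le> hyp_fun \<alpha> \<beta> \<kappa> t" if "0 < t" "t < 1" for t
  proof -
    \<comment> \<open>This integrates \<open>hyp_deriv_ge\<close> from 0 to t, giving logarithmic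
      growth at 1.\<close>
    have "hyp_fun \<alpha> \<beta> \<kappa> 0 + (\<kappa> / \<alpha>) * ln (1 - 0) \<le> hyp_fun \<alpha> \<beta> \<kappa> t + (\<kappa> / \<alpha>) * ln (1 - t)"
    proof (rule DERIV_nonneg_imp_nondecreasing[of 0 t "\<lambda>t. hyp_fun \<alpha> \<beta> \<kappa> t + (\<kappa> / \<alpha>) * ln (1 - t)"])
      fix x assume x: "0 \<le> x" "x \<le> t"
      have "((\<lambda>t. hyp_fun \<alpha> \<beta> \<kappa> t + (\<kappa> / \<alpha>) * ln (1 - t)) has_real_derivative
        hyp_deriv \<alpha> \<beta> \<kappa> x - (\<kappa> / \<alpha>) / (1 - x)) (at x)"
        using x that assms by (auto intro!: derivative_eq_intros hyp_fun_has_derivative)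
      moreover have "hyp_deriv \<alpha> \<beta> \<kappa> x - (\<kappa> / \<alpha>) / (1 - x) \<ge> 0"
        using hyp_deriv_ge[of \<alpha> \<beta> \<kappa> x] x that assms by simp
      ultimately show "\<exists>y. ((\<lambda>t. hyp_fun \<alpha> \<beta> \<kappa> t + (\<kappa> / \<alpha>) * ln (1 - t)) has_real_derivative y) (at x) \<and> 0 \<le> y"
        by blast
    qed (use that in auto)
    thus ?thesis by (simp add: hyp_fun_0)
  qed
  thus "\<forall>\<^sub>F t in at_left 1. 1 - (\<kappa> / \<alpha>) * ln (1 - t) \<le> hyp_fun \<alpha> \<beta> \<kappa> t"
    by (subst eventually_at_left[of 0]) (auto intro!: exI[of _ 0])
qed

text \<open>Since the denominator diverges as t tends to 1, finitely many terms do not influence the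
  quotient, and in the remaining ones \<open>r n\<close> is close to L.\<close>

lemma abelian_ratio_limit:
  fixes a r :: "nat \<Rightarrow> real"
  assumes a: "\<And>n. a n \<ge> 0" and r: "r \<longlonglongrightarrow> L"
    and sm: "\<And>t. 0 < t \<Longrightarrow> t < 1 \<Longrightarrow> summable (\<lambda>n. a n * t ^ n)"
    and lim: "filterlim (\<lambda>t. \<Sum>n. a n * t ^ n) at_top (at_left 1)"
    and g: "\<And>t. 0 < t \<Longrightarrow> t < 1 \<Longrightarrow> (\<lambda>n. r n * a n * t ^ n) sums g t"
  shows "((\<lambda>t. g t / (\<Sum>n. a n * t ^ n)) \<longlongrightarrow> L) (at_left 1)"
proof (rule tendstoI)
  fix e :: real assume e: "e > 0"
  let ?f = "\<lambda>t. \<Sum>n. a n * t ^ n"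
  obtain N where N: "\<And>n. n \<ge> N \<Longrightarrow> \<bar>r n - L\<bar> < e / 2"
    using LIMSEQ_D[OF r half_gt_zero[OF e]] by auto
  \<comment> \<open>K bounds the contribution of the first N terms for all t in (0,1) at once,
    because t^n \<le> 1.\<close>
  define K where "K = (\<Sum>n<N. \<bar>r n - L\<bar> * a n)"
  have bound: "\<bar>g t - L * ?f t\<bar> \<le> K + (e / 2) * ?f t" if t: "0 < t" "t < 1" for t
  proof -
    have fs: "(\<lambda>n. a n * t ^ n) sums ?f t" using sm[OF t] by (rule summable_sums)
    have 1: "(\<lambda>n. (r n - L) * (a n * t ^ n)) sums (g t - L * ?f t)"
      using sums_diff[OF g[OF t] sums_mult[OF fs, of L]] by (simp add: algebra_simps)
    have 2: "(\<lambda>n. (if n < N then \<bar>r n - L\<bar> * a n else 0) + (e / 2) * (a n * t ^ n)) sums (K + (e / 2) * ?f t)"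
      unfolding K_def
      by (intro sums_add sums_mult fs) (use sums_If_finite_set[of "{..<N}"] in simp)
    have le: "\<bar>(r n - L) * (a n * t ^ n)\<bar> \<le> (if n < N then \<bar>r n - L\<bar> * a n else 0) + (e / 2) * (a n * t ^ n)" for n
    proof (cases "n < N")
      case True
      have "t ^ n \<le> 1" using t by (intro power_le_one) auto
      hence "a n * t ^ n \<le> a n * 1" by (intro mult_left_mono a)
      hence "\<bar>r n - L\<bar> * (a n * t ^ n) \<le> \<bar>r n - L\<bar> * a n" by (intro mult_left_mono) auto
      moreover have "(e / 2) * (a n * t ^ n) \<ge> 0" using e t a by simp
      ultimately show ?thesis using True t a by (simp add: abs_mult)
    next
      case False
      hence "\<bar>r n - L\<bar> * (a n * t ^ n) \<le> (e / 2) * (a n * t ^ n)"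
        using t a N[of n] by (intro mult_right_mono) auto
      thus ?thesis using False t a by (simp add: abs_mult)
    qed
    have "g t - L * ?f t \<le> K + (e / 2) * ?f t"
      by (rule sums_le[OF _ 1 2]) (use le in \<open>auto simp: abs_le_iff simp del: abs_mult\<close>)
    moreover have "- (g t - L * ?f t) \<le> K + (e / 2) * ?f t"
      by (rule sums_le[OF _ sums_minus[OF 1] 2]) (meson le abs_le_iff)
    ultimately show ?thesis by (simp add: abs_le_iff)
  qed
  \<comment> \<open>Exceeding 2K/e makes K smaller than (e/2) times the denominator; the maximum
    with 0 makes the division legitimate.\<close>
  have "eventually (\<lambda>t. ?f t > max 0 (2 * K / e)) (at_left 1)"
    using lim by (simp only: filterlim_at_top_dense)
  moreover have "eventually (\<lambda>t. 0 < t \<and> t < (1::real)) (at_left 1)"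
    by (subst eventually_at_left[of 0]) (auto intro!: exI[of _ 0])
  ultimately show "eventually (\<lambda>t. dist (g t / ?f t) L < e) (at_left 1)"
  proof eventually_elim
    case (elim t)
    have f: "?f t > 0" "K < (e / 2) * ?f t" using elim(1) e by (auto simp: field_simps)
    have "\<bar>g t - L * ?f t\<bar> < e * ?f t" using bound[of t] elim(2) f(2) by simp
    moreover have "g t / ?f t - L = (g t - L * ?f t) / ?f t" using f(1) by (simp add: field_simps)
    ultimately show ?case using f(1) by (simp add: dist_real_def field_simps)
  qed
qed

text \<open>Multiplying the derivative by 1 - t turns its coefficients into (n+1) a(n+1) - n a(n),
  which by the recursion is a(n) times ((\<beta> - 1) n + \<kappa>) / (n + \<alpha>). This factor
  tends to \<beta> - 1, so the Abelian theorem applies.\<close>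

lemma hyp_log_deriv_limit:
  assumes "\<alpha> \<ge> 1" "\<beta> \<ge> 1" "\<kappa> > 0"
  shows "((\<lambda>t. (1 - t) * hyp_deriv \<alpha> \<beta> \<kappa> t / hyp_fun \<alpha> \<beta> \<kappa> t) \<longlongrightarrow> \<beta> - 1) (at_left 1)"
  unfolding hyp_fun_def
proof (rule abelian_ratio_limit)
  let ?a = "hyp_coeff \<alpha> \<beta> \<kappa>"
  let ?r = "\<lambda>n. ((\<beta> - 1) * real n + \<kappa>) / (real n + \<alpha>)"
  show "?r \<longlonglongrightarrow> \<beta> - 1" by real_asymp
  show "?a n \<ge> 0" for n using assms by (intro hyp_coeff_nonneg) auto
  show "filterlim (\<lambda>t. \<Sum>n. ?a n * t ^ n) at_top (at_left 1)"
    using hyp_fun_at_top[OF assms] by (simp add: hyp_fun_def[abs_def])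
  fix t :: real assume t: "0 < t" "t < 1"
  show "summable (\<lambda>n. ?a n * t ^ n)" using t by (intro hyp_summable) auto
  have sm: "summable (\<lambda>n. diffs ?a n * t ^ n)" using t by (intro hyp_diffs_summable) auto
  have "(\<lambda>n. diffs ?a n * t ^ n - real n * ?a n * t ^ n) sums (hyp_deriv \<alpha> \<beta> \<kappa> t - t * hyp_deriv \<alpha> \<beta> \<kappa> t)"
    unfolding hyp_deriv_def by (intro sums_diff summable_sums[OF sm] theta_sums[OF sm])
  moreover have "diffs ?a n * t ^ n - real n * ?a n * t ^ n = ?r n * ?a n * t ^ n" for n
  proof -
    have p: "real n + \<alpha> > 0" using assms by simp
    have "(real n + \<alpha>) * (diffs ?a n - real n * ?a n) =
      (real n + 1) * (real n + \<alpha>) * ?a (Suc n) - real n * (real n + \<alpha>) * ?a n"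
      unfolding diffs_def of_nat_Suc by (simp only: algebra_simps)
    also have "\<dots> = ((\<beta> - 1) * real n + \<kappa>) * ?a n"
      unfolding hyp_coeff_rec[OF assms(1)] by (simp only: algebra_simps power2_eq_square)
    finally have "diffs ?a n - real n * ?a n = ?r n * ?a n"
      using p by (simp add: field_simps del: hyp_coeff.simps)
    thus ?thesis by (metis left_diff_distrib)
  qed
  ultimately have "(\<lambda>n. ?r n * ?a n * t ^ n) sums (hyp_deriv \<alpha> \<beta> \<kappa> t - t * hyp_deriv \<alpha> \<beta> \<kappa> t)"
    by simp
  thus "(\<lambda>n. ?r n * ?a n * t ^ n) sums ((1 - t) * hyp_deriv \<alpha> \<beta> \<kappa> t)"
    by (simp only: left_diff_distrib mult_1_left)
qed

section \<open>The Riccati equation\<close>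

text \<open>The equation for h = w'/w when w solves the hypergeometric equation: D + h^2 stands for
  w''/w.\<close>

definition riccati :: "real \<Rightarrow> real \<Rightarrow> real \<Rightarrow> (real \<Rightarrow> real) \<Rightarrow> bool" where
  "riccati \<alpha> \<beta> \<kappa> h \<longleftrightarrow> (\<forall>t\<in>{0<..<1}. \<exists>D. (h has_real_derivative D) (at t) \<and>
     t * (1 - t) * (D + (h t)\<^sup>2) + (\<alpha> * (1 - t) - \<beta> * t) * h t = \<kappa>)"

lemma riccati_log_deriv:
  assumes "\<And>t. t \<in> {0<..<1} \<Longrightarrow> w t > 0"
    and "\<And>t. t \<in> {0<..<1} \<Longrightarrow> (w has_real_derivative w' t) (at t)"
    and "\<And>t. t \<in> {0<..<1} \<Longrightarrow> \<exists>D. (w' has_real_derivative D) (at t) \<and>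
            t * (1 - t) * D + (\<alpha> * (1 - t) - \<beta> * t) * w' t = \<kappa> * w t"
  shows "riccati \<alpha> \<beta> \<kappa> (\<lambda>t. w' t / w t)"
  unfolding riccati_def
proof
  fix t :: real assume t: "t \<in> {0<..<1}"
  from assms(3)[OF t] obtain D where D: "(w' has_real_derivative D) (at t)"
    "t * (1 - t) * D + (\<alpha> * (1 - t) - \<beta> * t) * w' t = \<kappa> * w t" by blast
  have w: "w t > 0" by (rule assms(1)[OF t])
  have "((\<lambda>t. w' t / w t) has_real_derivative (D / w t - (w' t / w t)\<^sup>2)) (at t)"
    using w by (auto intro!: derivative_eq_intros assms(2)[OF t] D simp: field_simps power2_eq_square)
  moreover have "t * (1 - t) * (D / w t) + (\<alpha> * (1 - t) - \<beta> * t) * (w' t / w t) = \<kappa>"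
  proof -
    have "t * (1 - t) * (D / w t) + (\<alpha> * (1 - t) - \<beta> * t) * (w' t / w t) =
      (t * (1 - t) * D + (\<alpha> * (1 - t) - \<beta> * t) * w' t) / w t"
      by (simp add: add_divide_distrib)
    thus ?thesis using D(2) w by simp
  qed
  ultimately show "\<exists>D. ((\<lambda>t. w' t / w t) has_real_derivative D) (at t) \<and>
      t * (1 - t) * (D + (w' t / w t)\<^sup>2) + (\<alpha> * (1 - t) - \<beta> * t) * (w' t / w t) = \<kappa>"
    by (intro exI[of _ "D / w t - (w' t / w t)\<^sup>2"]) simp
qed

text \<open>The way back from h to w: h is continuous on (0,1), so it has an antiderivative F there,
  and w = exp F.\<close>

lemma riccati_primitive:
  assumes "riccati \<alpha> \<beta> \<kappa> h"
  obtains w where "\<And>t. t \<in> {0<..<1} \<Longrightarrow> w t > 0"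
    "\<And>t. t \<in> {0<..<1} \<Longrightarrow> (w has_real_derivative h t * w t) (at t)"
proof -
  have "isCont h t" if "0 < t" "t < 1" for t
    using assms that unfolding riccati_def by (meson DERIV_isCont greaterThanLessThan_iff)
  hence "\<exists>F. \<forall>x. ereal 0 < ereal x \<longrightarrow> ereal x < ereal 1 \<longrightarrow> (F has_vector_derivative h x) (at x)"
    by (intro einterval_antiderivative) auto
  then obtain F where F: "\<And>t. t \<in> {0<..<1} \<Longrightarrow> (F has_real_derivative h t) (at t)"
    by (auto simp: has_real_derivative_iff_has_vector_derivative)
  show ?thesis
    by (rule that[of "\<lambda>t. exp (F t)"]) (auto intro!: derivative_eq_intros F)
qed

text \<open>The Sturm-Liouville weight of the hypergeometric equation: its logarithmic derivative
  \<alpha>/t - \<beta>/(1-t) is the coefficient of w' after division by t(1-t).\<close>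

definition weight :: "real \<Rightarrow> real \<Rightarrow> real \<Rightarrow> real" where
  "weight \<alpha> \<beta> t = t powr \<alpha> * (1 - t) powr \<beta>"

lemma weight_pos: "0 < t \<Longrightarrow> t < 1 \<Longrightarrow> weight \<alpha> \<beta> t > 0"
  by (simp add: weight_def)

text \<open>This makes 1/\<open>weight\<close> non-integrable at 0, which is what excludes a
  negative Wronskian in the comparison with \<open>hyp_fun\<close>.\<close>

lemma weight_le:
  assumes "\<alpha> \<ge> 1" "\<beta> \<ge> 1" "0 < t" "t < 1"
  shows "weight \<alpha> \<beta> t \<le> t"
proof -
  have "t powr \<alpha> \<le> t powr 1" using assms by (intro powr_mono') auto
  moreover have "(1 - t) powr \<beta> \<le> (1 - t) powr 0" using assms by (intro powr_mono') auto
  ultimately have "t powr \<alpha> * (1 - t) powr \<beta> \<le> t * 1"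
    using assms by (intro mult_mono) auto
  thus ?thesis by (simp add: weight_def)
qed

lemma weight_has_derivative:
  assumes "0 < t" "t < 1"
  shows "(weight \<alpha> \<beta> has_real_derivative weight \<alpha> \<beta> t * (\<alpha> / t - \<beta> / (1 - t))) (at t)"
  unfolding weight_def
  using assms by (auto intro!: derivative_eq_intros simp: powr_diff field_simps)

text \<open>Abel's identity: w v (k - h) is the Wronskian w v' - w' v, and the weight is the
  integrating factor that makes it constant.\<close>

lemma wronskian_constant:
  assumes h: "riccati \<alpha> \<beta> \<kappa> h" and k: "riccati \<alpha> \<beta> \<kappa> k"
    and w: "\<And>t. t \<in> {0<..<1} \<Longrightarrow> (w has_real_derivative h t * w t) (at t)"
    and v: "\<And>t. t \<in> {0<..<1} \<Longrightarrow> (v has_real_derivative k t * v t) (at t)"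
  obtains C where "\<And>t. t \<in> {0<..<1} \<Longrightarrow> weight \<alpha> \<beta> t * w t * v t * (k t - h t) = C"
proof -
  have "((\<lambda>t. weight \<alpha> \<beta> t * w t * v t * (k t - h t)) has_real_derivative 0) (at t)"
    if t: "t \<in> {0<..<1}" for t
  proof -
    obtain D where D: "(h has_real_derivative D) (at t)"
      "t * (1 - t) * (D + (h t)\<^sup>2) + (\<alpha> * (1 - t) - \<beta> * t) * h t = \<kappa>"
      using h t unfolding riccati_def by blast
    obtain E where E: "(k has_real_derivative E) (at t)"
      "t * (1 - t) * (E + (k t)\<^sup>2) + (\<alpha> * (1 - t) - \<beta> * t) * k t = \<kappa>"
      using k t unfolding riccati_def by blast
    define c where "c = \<alpha> / t - \<beta> / (1 - t)"
    have t': "0 < t" "t < 1" using t by auto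
    have c: "\<alpha> * (1 - t) - \<beta> * t = t * (1 - t) * c"
      using t' by (simp add: c_def field_simps)
    have "t * (1 - t) * ((D + (h t)\<^sup>2 + c * h t) - (E + (k t)\<^sup>2 + c * k t)) = 0"
      using D(2) E(2) unfolding c by (simp add: algebra_simps)
    \<comment> \<open>Subtracting the two Riccati equations eliminates \<kappa>.\<close>
    hence eq: "E - D = (h t)\<^sup>2 + c * h t - (k t)\<^sup>2 - c * k t" using t' by simp
    have "((\<lambda>t. weight \<alpha> \<beta> t * w t * v t * (k t - h t)) has_real_derivative
      weight \<alpha> \<beta> t * w t * v t * (c * (k t - h t) + (h t + k t) * (k t - h t) + (E - D))) (at t)"
      unfolding c_def
      by (auto intro!: derivative_eq_intros weight_has_derivative t' w[OF t] v[OF t] D(1) E(1)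
            simp: algebra_simps simp del: times_divide_eq_left times_divide_eq_right)
    moreover have "c * (k t - h t) + (h t + k t) * (k t - h t) + (E - D) = 0"
      unfolding eq by (simp add: algebra_simps power2_eq_square)
    ultimately show ?thesis by simp
  qed
  hence "\<exists>c. \<forall>x\<in>{0<..<1}. weight \<alpha> \<beta> x * w x * v x * (k x - h x) = c"
    by (intro has_field_derivative_zero_constant) (auto intro: has_field_derivative_at_within)
  thus ?thesis using that by blast
qed

text \<open>Equality at one point forces the constant weighted Wronskian to be 0, and its other
  factors are positive. No Lipschitz estimate is involved.\<close>

lemma riccati_unique:
  assumes h: "riccati \<alpha> \<beta> \<kappa> h" and k: "riccati \<alpha> \<beta> \<kappa> k"
    and s: "s \<in> {0<..<1}" "h s = k s" and t: "t \<in> {0<..<1}"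
  shows "h t = k t"
proof -
  obtain w where w: "\<And>t. t \<in> {0<..<1} \<Longrightarrow> w t > 0"
    "\<And>t. t \<in> {0<..<1} \<Longrightarrow> (w has_real_derivative h t * w t) (at t)"
    using riccati_primitive[OF h] by blast
  obtain v where v: "\<And>t. t \<in> {0<..<1} \<Longrightarrow> v t > 0"
    "\<And>t. t \<in> {0<..<1} \<Longrightarrow> (v has_real_derivative k t * v t) (at t)"
    using riccati_primitive[OF k] by blast
  obtain C where C: "\<And>t. t \<in> {0<..<1} \<Longrightarrow> weight \<alpha> \<beta> t * w t * v t * (k t - h t) = C"
    using wronskian_constant[OF h k w(2) v(2)] by blast
  have "C = 0" using C[OF s(1)] s(2) by simp
  thus ?thesis using C[OF t] w(1)[OF t] v(1)[OF t] weight_pos[of t \<alpha> \<beta>] t by auto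
qed

lemma riccati_hyp:
  assumes "\<alpha> \<ge> 1" "\<beta> \<ge> 1" "\<kappa> \<ge> 0"
  shows "riccati \<alpha> \<beta> \<kappa> (\<lambda>t. hyp_deriv \<alpha> \<beta> \<kappa> t / hyp_fun \<alpha> \<beta> \<kappa> t)"
proof (rule riccati_log_deriv)
  fix t :: real assume t: "t \<in> {0<..<1}"
  show "hyp_fun \<alpha> \<beta> \<kappa> t > 0" using hyp_fun_ge_1[OF assms, of t] t by simp
  show "(hyp_fun \<alpha> \<beta> \<kappa> has_real_derivative hyp_deriv \<alpha> \<beta> \<kappa> t) (at t)"
    using t by (intro hyp_fun_has_derivative) auto
  show "\<exists>D. (hyp_deriv \<alpha> \<beta> \<kappa> has_real_derivative D) (at t) \<and>
      t * (1 - t) * D + (\<alpha> * (1 - t) - \<beta> * t) * hyp_deriv \<alpha> \<beta> \<kappa> t = \<kappa> * hyp_fun \<alpha> \<beta> \<kappa> t"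
    using hyp_deriv_has_derivative[of t \<alpha> \<beta> \<kappa>] t assms(1) by fastforce
qed

text \<open>The reflection t -> 1 - t exchanges the singular points 0 and 1 and hence \<alpha> and
  \<beta>; a logarithmic derivative changes sign. Facts at one end thereby transfer to the
  other.\<close>

lemma riccati_reflect:
  assumes "riccati \<alpha> \<beta> \<kappa> h"
  shows "riccati \<beta> \<alpha> \<kappa> (\<lambda>t. - h (1 - t))"
  unfolding riccati_def
proof
  fix t :: real assume t: "t \<in> {0<..<1}"
  hence "1 - t \<in> {0<..<1}" by auto
  then obtain D where D: "(h has_real_derivative D) (at (1 - t))"
    "(1 - t) * (1 - (1 - t)) * (D + (h (1 - t))\<^sup>2) + (\<alpha> * (1 - (1 - t)) - \<beta> * (1 - t)) * h (1 - t) = \<kappa>"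
    using assms unfolding riccati_def by blast
  have "((\<lambda>t. h (1 - t)) has_real_derivative D * (0 - 1)) (at t)"
    by (rule DERIV_chain2[where f = h and g = "\<lambda>t. 1 - t", OF D(1)]) (auto intro!: derivative_eq_intros)
  from DERIV_minus[OF this] have "((\<lambda>t. - h (1 - t)) has_real_derivative D) (at t)" by simp
  moreover have "t * (1 - t) * (D + (- h (1 - t))\<^sup>2) + (\<beta> * (1 - t) - \<alpha> * t) * (- h (1 - t)) = \<kappa>"
    using D(2) by (simp add: algebra_simps)
  ultimately show "\<exists>D. ((\<lambda>t. - h (1 - t)) has_real_derivative D) (at t) \<and>
     t * (1 - t) * (D + (- h (1 - t))\<^sup>2) + (\<beta> * (1 - t) - \<alpha> * t) * (- h (1 - t)) = \<kappa>" by blast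
qed

text \<open>The bound holds because a negative Wronskian would give (w / \<phi>)' \<ge> c / t near 0 for
  \<phi> = hyp_fun and a positive w with w' = h w, so that w / \<phi> would tend to - \<infinity> at 0.\<close>
lemma riccati_le_hyp:
  assumes ab: "\<alpha> \<ge> 1" "\<beta> \<ge> 1" "\<kappa> \<ge> 0" and h: "riccati \<alpha> \<beta> \<kappa> h" and t: "0 < t" "t < 1"
  shows "h t \<le> hyp_deriv \<alpha> \<beta> \<kappa> t / hyp_fun \<alpha> \<beta> \<kappa> t"
proof -
  define \<phi> where "\<phi> = hyp_fun \<alpha> \<beta> \<kappa>"
  define k where "k = (\<lambda>t. hyp_deriv \<alpha> \<beta> \<kappa> t / \<phi> t)"
  have \<phi>1: "\<phi> t \<ge> 1" if "0 < t" "t < 1" for t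
    unfolding \<phi>_def using hyp_fun_ge_1[OF ab] that by simp
  have k: "riccati \<alpha> \<beta> \<kappa> k" unfolding k_def \<phi>_def by (rule riccati_hyp[OF ab])
  have \<phi>: "(\<phi> has_real_derivative k t * \<phi> t) (at t)" if "t \<in> {0<..<1}" for t
  proof -
    have "k t * \<phi> t = hyp_deriv \<alpha> \<beta> \<kappa> t" using \<phi>1[of t] that by (simp add: k_def)
    thus ?thesis unfolding \<phi>_def using that hyp_fun_has_derivative[of t] by simp
  qed
  obtain w where w: "\<And>t. t \<in> {0<..<1} \<Longrightarrow> w t > 0"
    "\<And>t. t \<in> {0<..<1} \<Longrightarrow> (w has_real_derivative h t * w t) (at t)"
    using riccati_primitive[OF h] by blast
  obtain C where C: "\<And>t. t \<in> {0<..<1} \<Longrightarrow> weight \<alpha> \<beta> t * w t * \<phi> t * (k t - h t) = C"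
    using wronskian_constant[OF h k w(2) \<phi>] by blast
  have "C \<ge> 0"
  proof (rule ccontr)
    assume "\<not> C \<ge> 0"
    \<comment> \<open>On (0,1/2] one has \<open>weight\<close> \<le> x and \<phi> \<le> \<phi>(1/2),
      so the derivative -C / (\<open>weight\<close> \<phi>^2) of w/\<phi> is at least c/x with this
      c.\<close>
    define c where "c = - C / (\<phi> (1/2))\<^sup>2"
    define M where "M = w (1/2) / \<phi> (1/2)"
    \<comment> \<open>Chosen so that c ln s = c ln (1/2) - M: integrating c/x from s to 1/2 uses up
      the whole value M of w/\<phi> at 1/2.\<close>
    define s where "s = exp (- (M / c)) / 2"
    have c: "c > 0" using \<open>\<not> C \<ge> 0\<close> \<phi>1[of "1/2"] by (simp add: c_def divide_neg_pos)
    have M: "M > 0" using w(1)[of "1/2"] \<phi>1[of "1/2"] by (simp add: M_def)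
    have s: "0 < s" "s \<le> 1/2" using c M by (auto simp: s_def)
    have "w s / \<phi> s - c * ln s \<le> w (1/2) / \<phi> (1/2) - c * ln (1/2)"
    proof (rule DERIV_nonneg_imp_nondecreasing[OF s(2)])
      fix x :: real assume x: "s \<le> x" "x \<le> 1/2"
      have x': "0 < x" "x < 1" "x \<in> {0<..<1}" using x s by auto
      have d: "((\<lambda>s. w s / \<phi> s - c * ln s) has_real_derivative w x * (h x - k x) / \<phi> x - c / x) (at x)"
        using \<phi>1[of x] x' by (auto intro!: derivative_eq_intros w(2) \<phi> simp: field_simps)
      have p: "weight \<alpha> \<beta> x > 0" using weight_pos x' by simp
      have "w x * (h x - k x) / \<phi> x = - C / (weight \<alpha> \<beta> x * (\<phi> x)\<^sup>2)"
        using p \<phi>1[of x] x' by (simp add: C[OF x'(3), symmetric] field_simps power2_eq_square)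
      moreover have "c / x \<le> - C / (weight \<alpha> \<beta> x * (\<phi> x)\<^sup>2)"
      proof -
        have "\<phi> x \<le> \<phi> (1/2)" unfolding \<phi>_def using x x' by (intro hyp_fun_mono[OF ab]) auto
        hence "weight \<alpha> \<beta> x * (\<phi> x)\<^sup>2 \<le> x * (\<phi> (1/2))\<^sup>2"
          using weight_le[OF ab(1,2) x'(1,2)] x' \<phi>1[of x] by (intro mult_mono power_mono) auto
        moreover have "weight \<alpha> \<beta> x * (\<phi> x)\<^sup>2 > 0" using p \<phi>1[of x] x' by simp
        ultimately have "- C / (x * (\<phi> (1/2))\<^sup>2) \<le> - C / (weight \<alpha> \<beta> x * (\<phi> x)\<^sup>2)"
          using \<open>\<not> C \<ge> 0\<close> by (intro divide_left_mono) auto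
        thus ?thesis by (simp add: c_def mult.commute)
      qed
      ultimately show "\<exists>y. ((\<lambda>s. w s / \<phi> s - c * ln s) has_real_derivative y) (at x) \<and> 0 \<le> y"
        using d by (intro exI conjI) auto
    qed
    moreover have "c * ln s = - M + c * ln (1/2)"
      using c by (simp add: s_def ln_div algebra_simps)
    ultimately have "w s / \<phi> s \<le> 0" by (simp add: M_def)
    moreover have "w s / \<phi> s > 0" using w(1)[of s] \<phi>1[of s] s by (intro divide_pos_pos) auto
    ultimately show False by simp
  qed
  moreover have "weight \<alpha> \<beta> t * w t * \<phi> t > 0"
    using weight_pos[OF t] w(1)[of t] \<phi>1[OF t] t by simp
  ultimately have "k t - h t \<ge> 0" using C[of t] t by (metis zero_le_mult_iff not_le greaterThanLessThan_iff)
  thus ?thesis by (simp add: k_def \<phi>_def)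
qed

section \<open>The one-parameter family of solutions\<close>

text \<open>The logarithmic derivative of l w1 + (1 - l) w2, where w2 is the series at t = 1; the
  minus sign in the numerator comes from the inner function 1 - t.\<close>

definition sol_family :: "real \<Rightarrow> real \<Rightarrow> real \<Rightarrow> real \<Rightarrow> real \<Rightarrow> real" where
  "sol_family \<alpha> \<beta> \<kappa> l t =
     (l * hyp_deriv \<alpha> \<beta> \<kappa> t - (1 - l) * hyp_deriv \<beta> \<alpha> \<kappa> (1 - t)) /
     (l * hyp_fun \<alpha> \<beta> \<kappa> t + (1 - l) * hyp_fun \<beta> \<alpha> \<kappa> (1 - t))"

lemma sol_family_reflect: "sol_family \<alpha> \<beta> \<kappa> l t = - sol_family \<beta> \<alpha> \<kappa> (1 - l) (1 - t)"
  by (simp add: sol_family_def add.commute minus_divide_left)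

lemma sol_family_denom_ge_1:
  assumes "\<alpha> \<ge> 1" "\<beta> \<ge> 1" "\<kappa> \<ge> 0" "0 \<le> l" "l \<le> 1" "0 < t" "t < 1"
  shows "l * hyp_fun \<alpha> \<beta> \<kappa> t + (1 - l) * hyp_fun \<beta> \<alpha> \<kappa> (1 - t) \<ge> 1"
proof -
  have "l * 1 + (1 - l) * 1 \<le> l * hyp_fun \<alpha> \<beta> \<kappa> t + (1 - l) * hyp_fun \<beta> \<alpha> \<kappa> (1 - t)"
    using assms by (intro add_mono mult_left_mono hyp_fun_ge_1) auto
  thus ?thesis by simp
qed

lemma riccati_sol_family:
  assumes ab: "\<alpha> \<ge> 1" "\<beta> \<ge> 1" "\<kappa> \<ge> 0" and l: "0 \<le> l" "l \<le> 1"
  shows "riccati \<alpha> \<beta> \<kappa> (sol_family \<alpha> \<beta> \<kappa> l)"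
  unfolding sol_family_def[abs_def]
proof (rule riccati_log_deriv)
  fix t :: real assume "t \<in> {0<..<1}"
  hence t: "0 < t" "t < 1" "\<bar>t\<bar> < 1" "\<bar>1 - t\<bar> < 1" by auto
  let ?w = "\<lambda>t. l * hyp_fun \<alpha> \<beta> \<kappa> t + (1 - l) * hyp_fun \<beta> \<alpha> \<kappa> (1 - t)"
  let ?w' = "\<lambda>t. l * hyp_deriv \<alpha> \<beta> \<kappa> t - (1 - l) * hyp_deriv \<beta> \<alpha> \<kappa> (1 - t)"
  show "?w t > 0" using sol_family_denom_ge_1[OF ab l t(1,2)] by simp
  have refl: "((\<lambda>t. 1 - t) has_real_derivative - 1) (at t)"
    by (auto intro!: derivative_eq_intros)
  have "((\<lambda>t. hyp_fun \<beta> \<alpha> \<kappa> (1 - t)) has_real_derivative hyp_deriv \<beta> \<alpha> \<kappa> (1 - t) * - 1) (at t)"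
    by (rule DERIV_chain2[where g = "\<lambda>t. 1 - t", OF hyp_fun_has_derivative refl]) (rule t)
  thus "(?w has_real_derivative ?w' t) (at t)"
    by (auto intro!: derivative_eq_intros hyp_fun_has_derivative t)
  obtain D where D: "(hyp_deriv \<alpha> \<beta> \<kappa> has_real_derivative D) (at t)"
    "t * (1 - t) * D + (\<alpha> * (1 - t) - \<beta> * t) * hyp_deriv \<alpha> \<beta> \<kappa> t = \<kappa> * hyp_fun \<alpha> \<beta> \<kappa> t"
    using hyp_deriv_has_derivative[OF t(3) ab(1)] by blast
  obtain E where E: "(hyp_deriv \<beta> \<alpha> \<kappa> has_real_derivative E) (at (1 - t))"
    "(1 - t) * (1 - (1 - t)) * E + (\<beta> * (1 - (1 - t)) - \<alpha> * (1 - t)) * hyp_deriv \<beta> \<alpha> \<kappa> (1 - t)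
       = \<kappa> * hyp_fun \<beta> \<alpha> \<kappa> (1 - t)"
    using hyp_deriv_has_derivative[OF t(4) ab(2)] by blast
  have "((\<lambda>t. hyp_deriv \<beta> \<alpha> \<kappa> (1 - t)) has_real_derivative E * - 1) (at t)"
    by (rule DERIV_chain2[where g = "\<lambda>t. 1 - t", OF E(1) refl])
  hence "(?w' has_real_derivative l * D + (1 - l) * E) (at t)"
    by (auto intro!: derivative_eq_intros D(1))
  moreover have "t * (1 - t) * (l * D + (1 - l) * E) + (\<alpha> * (1 - t) - \<beta> * t) * ?w' t = \<kappa> * ?w t"
  proof -
    have "t * (1 - t) * (l * D + (1 - l) * E) + (\<alpha> * (1 - t) - \<beta> * t) * ?w' t =
      l * (t * (1 - t) * D + (\<alpha> * (1 - t) - \<beta> * t) * hyp_deriv \<alpha> \<beta> \<kappa> t) +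
      (1 - l) * ((1 - t) * (1 - (1 - t)) * E + (\<beta> * (1 - (1 - t)) - \<alpha> * (1 - t)) * hyp_deriv \<beta> \<alpha> \<kappa> (1 - t))"
      by (simp add: algebra_simps)
    also have "\<dots> = \<kappa> * ?w t" unfolding D(2) E(2) by (simp add: algebra_simps)
    finally show ?thesis .
  qed
  ultimately show "\<exists>D. (?w' has_real_derivative D) (at t) \<and>
     t * (1 - t) * D + (\<alpha> * (1 - t) - \<beta> * t) * ?w' t = \<kappa> * ?w t" by blast
qed

text \<open>The upper bound is \<open>riccati_le_hyp\<close>, since l = 1 leaves only w1. The lower
  bound is the same lemma for the reflected equation.\<close>

lemma riccati_bounds:
  assumes ab: "\<alpha> \<ge> 1" "\<beta> \<ge> 1" "\<kappa> \<ge> 0" and h: "riccati \<alpha> \<beta> \<kappa> h" and t: "0 < t" "t < 1"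
  shows "sol_family \<alpha> \<beta> \<kappa> 0 t \<le> h t" "h t \<le> sol_family \<alpha> \<beta> \<kappa> 1 t"
  using riccati_le_hyp[OF ab h t] riccati_le_hyp[OF ab(2,1,3) riccati_reflect[OF h], of "1 - t"] t
  by (simp_all add: sol_family_def)

lemma sol_family_continuous:
  assumes "\<alpha> \<ge> 1" "\<beta> \<ge> 1" "\<kappa> \<ge> 0" "0 < t" "t < 1"
  shows "continuous_on {0..1} (\<lambda>l. sol_family \<alpha> \<beta> \<kappa> l t)"
  unfolding sol_family_def
proof (intro continuous_intros ballI)
  fix l :: real assume "l \<in> {0..1}"
  thus "l * hyp_fun \<alpha> \<beta> \<kappa> t + (1 - l) * hyp_fun \<beta> \<alpha> \<kappa> (1 - t) \<noteq> 0"
    using sol_family_denom_ge_1[OF assms(1-3) _ _ assms(4,5), of l] by auto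
qed

lemma sol_family_strict_mono:
  assumes ab: "\<alpha> \<ge> 1" "\<beta> \<ge> 1" "\<kappa> > 0" and t: "0 < t" "t < 1" and l: "0 \<le> l" "l < m" "m \<le> 1"
  shows "sol_family \<alpha> \<beta> \<kappa> l t < sol_family \<alpha> \<beta> \<kappa> m t"
proof -
  have k: "\<kappa> \<ge> 0" using ab by simp
  define w w' v v' where defs: "w = hyp_fun \<alpha> \<beta> \<kappa> t" "w' = hyp_deriv \<alpha> \<beta> \<kappa> t"
    "v = hyp_fun \<beta> \<alpha> \<kappa> (1 - t)" "v' = hyp_deriv \<beta> \<alpha> \<kappa> (1 - t)"
  have "\<kappa> / \<alpha> / (1 - t) > 0" "\<kappa> / \<beta> / (1 - (1 - t)) > 0" using ab t by auto
  hence pos: "w' > 0" "v' > 0"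
    using hyp_deriv_ge[OF ab(1,2) k, of t] hyp_deriv_ge[OF ab(2,1) k, of "1 - t"] t
    unfolding defs by linarith+
  have "w \<ge> 1" "v \<ge> 1"
    using hyp_fun_ge_1[OF ab(1,2) k, of t] hyp_fun_ge_1[OF ab(2,1) k, of "1 - t"] t unfolding defs by auto
  hence "w' * v + v' * w > 0" using pos by (intro add_pos_pos mult_pos_pos) auto
  have dl: "l * w + (1 - l) * v > 0" and dm: "m * w + (1 - m) * v > 0"
    using sol_family_denom_ge_1[OF ab(1,2) k _ _ t, of l] sol_family_denom_ge_1[OF ab(1,2) k _ _ t, of m] l
    unfolding defs by auto
  \<comment> \<open>Cross-multiplying the two fractions leaves (m - l) times the Wronskian of w1 and
    w2, whose two summands are positive because \<kappa> > 0.\<close>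
  have "(m * w' - (1 - m) * v') * (l * w + (1 - l) * v) - (l * w' - (1 - l) * v') * (m * w + (1 - m) * v)
     = (m - l) * (w' * v + v' * w)"
    by (simp add: algebra_simps)
  also have "\<dots> > 0" using \<open>w' * v + v' * w > 0\<close> l by simp
  finally show ?thesis
    using dl dm unfolding sol_family_def defs[symmetric] by (simp add: divide_less_eq less_divide_eq)
qed

section \<open>Limits of the family at the singular points\<close>

lemma sol_family_right_limit:
  assumes ab: "\<alpha> \<ge> 1" "\<beta> \<ge> 1" "\<kappa> \<ge> 0" and l: "0 < l" "l \<le> 1" and k: "\<kappa> > 0"
  shows "((\<lambda>t. (1 - t) * sol_family \<alpha> \<beta> \<kappa> l t) \<longlongrightarrow> \<beta> - 1) (at_left 1)"
proof -
  define w w' v v' where defs: "w = hyp_fun \<alpha> \<beta> \<kappa>" "w' = hyp_deriv \<alpha> \<beta> \<kappa>"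
    "v = (\<lambda>t. hyp_fun \<beta> \<alpha> \<kappa> (1 - t))" "v' = (\<lambda>t. hyp_deriv \<beta> \<alpha> \<kappa> (1 - t))"
  have cont: "isCont (hyp_fun \<beta> \<alpha> \<kappa>) 0" "isCont (hyp_deriv \<beta> \<alpha> \<kappa>) 0"
    using hyp_fun_has_derivative[of 0] hyp_deriv_has_derivative[of 0 \<beta>] ab by (metis DERIV_isCont abs_zero zero_less_one)+
  have r: "((\<lambda>t::real. 1 - t) \<longlongrightarrow> 0) (at_left 1)" by (auto intro!: tendsto_eq_intros)
  have v: "(v \<longlongrightarrow> 1) (at_left 1)" and v': "(v' \<longlongrightarrow> hyp_deriv \<beta> \<alpha> \<kappa> 0) (at_left 1)"
    using isCont_tendsto_compose[OF cont(1) r] isCont_tendsto_compose[OF cont(2) r]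
    by (simp_all add: defs hyp_fun_0)
  have w: "filterlim w at_top (at_left 1)" unfolding defs by (rule hyp_fun_at_top[OF ab(1,2) k])
  have i: "((\<lambda>t. inverse (w t)) \<longlongrightarrow> 0) (at_left 1)"
    by (rule tendsto_inverse_0_at_top[OF w])
  \<comment> \<open>Numerator and denominator are divided by w, which diverges while v and v' stay
    bounded. Because l > 0, the denominator has the nonzero limit l, and w alone decides the
    limit.\<close>
  have "((\<lambda>t. (l * ((1 - t) * w' t / w t) - (1 - l) * ((1 - t) * v' t * inverse (w t))) /
             (l + (1 - l) * (v t * inverse (w t)))) \<longlongrightarrow>
          (l * (\<beta> - 1) - (1 - l) * (0 * hyp_deriv \<beta> \<alpha> \<kappa> 0 * 0)) / (l + (1 - l) * (1 * 0))) (at_left 1)"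
    using l by (intro tendsto_intros r v v' i hyp_log_deriv_limit[OF ab(1,2) k, folded defs]) auto
  hence "((\<lambda>t. (l * ((1 - t) * w' t / w t) - (1 - l) * ((1 - t) * v' t * inverse (w t))) /
             (l + (1 - l) * (v t * inverse (w t)))) \<longlongrightarrow> \<beta> - 1) (at_left 1)"
    using l by simp
  moreover have "eventually (\<lambda>t. (l * ((1 - t) * w' t / w t) - (1 - l) * ((1 - t) * v' t * inverse (w t))) /
             (l + (1 - l) * (v t * inverse (w t))) = (1 - t) * sol_family \<alpha> \<beta> \<kappa> l t) (at_left 1)"
    using filterlim_at_top_dense[THEN iffD1, OF w, rule_format, of 0]
  proof eventually_elim
    case (elim t)
    have "(l * ((1 - t) * w' t / w t) - (1 - l) * ((1 - t) * v' t * inverse (w t))) /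
             (l + (1 - l) * (v t * inverse (w t))) =
          (w t * (l * ((1 - t) * w' t / w t) - (1 - l) * ((1 - t) * v' t * inverse (w t)))) /
             (w t * (l + (1 - l) * (v t * inverse (w t))))"
      using elim by simp
    also have "w t * (l * ((1 - t) * w' t / w t) - (1 - l) * ((1 - t) * v' t * inverse (w t)))
        = (1 - t) * (l * w' t - (1 - l) * v' t)"
      using elim by (simp add: field_simps)
    also have "w t * (l + (1 - l) * (v t * inverse (w t))) = l * w t + (1 - l) * v t"
      using elim by (simp add: field_simps)
    finally show ?case by (simp add: sol_family_def defs)
  qed
  ultimately show ?thesis by (rule Lim_transform_eventually)
qed

text \<open>For l = 0 only w2 remains. It is analytic at t = 1 with value 1, so its logarithmic
  derivative is bounded there; this is the source of the exceptional boundary value.\<close>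

lemma sol_family_right_limit_0:
  assumes ab: "\<alpha> \<ge> 1" "\<beta> \<ge> 1" "\<kappa> \<ge> 0"
  shows "((\<lambda>t. (1 - t) * sol_family \<alpha> \<beta> \<kappa> 0 t) \<longlongrightarrow> 0) (at_left 1)"
proof -
  have cont: "isCont (hyp_fun \<beta> \<alpha> \<kappa>) 0" "isCont (hyp_deriv \<beta> \<alpha> \<kappa>) 0"
    using hyp_fun_has_derivative[of 0] hyp_deriv_has_derivative[of 0 \<beta>] ab by (metis DERIV_isCont abs_zero zero_less_one)+
  have r: "((\<lambda>t::real. 1 - t) \<longlongrightarrow> 0) (at_left 1)" by (auto intro!: tendsto_eq_intros)
  have "((\<lambda>t. (1 - t) * (- hyp_deriv \<beta> \<alpha> \<kappa> (1 - t) / hyp_fun \<beta> \<alpha> \<kappa> (1 - t))) \<longlongrightarrow>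
       0 * (- hyp_deriv \<beta> \<alpha> \<kappa> 0 / hyp_fun \<beta> \<alpha> \<kappa> 0)) (at_left 1)"
    by (intro tendsto_intros r isCont_tendsto_compose[OF cont(1) r] isCont_tendsto_compose[OF cont(2) r])
       (simp add: hyp_fun_0)
  thus ?thesis by (simp add: sol_family_def)
qed

lemma tendsto_reflect:
  fixes f :: "real \<Rightarrow> real"
  assumes "((\<lambda>t. (1 - t) * f t) \<longlongrightarrow> L) (at_left 1)"
  shows "((\<lambda>t. t * - f (1 - t)) \<longlongrightarrow> - L) (at_right 0)"
proof -
  have "filterlim (\<lambda>t::real. 1 - t) (at_left 1) (at_right 0)"
    unfolding filterlim_at by (auto intro!: tendsto_eq_intros simp: eventually_at_filter)
  from tendsto_minus[OF filterlim_compose[OF assms this]] show ?thesis by simp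
qed

lemma sol_family_left_limit:
  assumes "\<alpha> \<ge> 1" "\<beta> \<ge> 1" "\<kappa> > 0" and "0 \<le> l" "l < 1"
  shows "((\<lambda>t. t * sol_family \<alpha> \<beta> \<kappa> l t) \<longlongrightarrow> 1 - \<alpha>) (at_right 0)"
  using tendsto_reflect[OF sol_family_right_limit[of \<beta> \<alpha> \<kappa> "1 - l"]] assms
  by (simp flip: sol_family_reflect)

lemma sol_family_left_limit_1:
  assumes "\<alpha> \<ge> 1" "\<beta> \<ge> 1" "\<kappa> \<ge> 0"
  shows "((\<lambda>t. t * sol_family \<alpha> \<beta> \<kappa> 1 t) \<longlongrightarrow> 0) (at_right 0)"
  using tendsto_reflect[OF sol_family_right_limit_0[OF assms(2,1,3)]] sol_family_reflect[of \<alpha> \<beta> \<kappa> 1]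
  by simp

section \<open>The ODE on (-1,1)\<close>

lemma smooth_on_closed_family:
  fixes A :: "(real \<Rightarrow> real) set"
  assumes "open S" "f \<in> A"
    and closed: "\<And>g. g \<in> A \<Longrightarrow> \<exists>g'\<in>A. \<forall>x\<in>S. (g has_real_derivative g' x) (at x)"
  shows "smooth_on S f"
proof -
  \<comment> \<open>An iterated \<open>deriv\<close> is known to agree with a member of A on S only;
    openness of S transfers the derivative to such a k.\<close>
  have step: "\<exists>g'\<in>A. \<forall>x\<in>S. (k has_real_derivative g' x) (at x)"
    if g: "g \<in> A" "\<forall>x\<in>S. k x = g x" for g k
  proof -
    obtain g' where "g' \<in> A" "\<forall>x\<in>S. (g has_real_derivative g' x) (at x)"
      using closed[OF g(1)] by blast
    moreover from this have "(k has_real_derivative g' x) (at x)" if "x \<in> S" for x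
      using that g(2) \<open>open S\<close> by (auto intro: has_field_derivative_transform_within_open[of g])
    ultimately show ?thesis by blast
  qed
  have "\<exists>g\<in>A. \<forall>x\<in>S. (deriv ^^ n) f x = g x" for n
  proof (induction n)
    case (Suc n)
    then obtain g where "g \<in> A" "\<forall>x\<in>S. (deriv ^^ n) f x = g x" by blast
    from step[OF this] show ?case by (auto dest: DERIV_imp_deriv)
  qed (use assms in auto)
  hence "(deriv ^^ n) f differentiable (at x)" if "x \<in> S" for n x
    using step[of _ "(deriv ^^ n) f"] that by (meson real_differentiable_def)
  thus ?thesis by (simp add: smooth_on_def)
qed

text \<open>The ODE expresses U' as a polynomial in x, U and 1/(1 - x^2). The algebra generated by
  these is therefore closed under differentiation on (-1,1), by induction over its rules.\<close>

inductive_set ode_algebra :: "(real \<Rightarrow> real) \<Rightarrow> (real \<Rightarrow> real) set" for U where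
  const: "(\<lambda>x. c) \<in> ode_algebra U"
| ident: "(\<lambda>x. x) \<in> ode_algebra U"
| recip: "(\<lambda>x. 1 / (1 - x\<^sup>2)) \<in> ode_algebra U"
| sol: "U \<in> ode_algebra U"
| add: "f \<in> ode_algebra U \<Longrightarrow> g \<in> ode_algebra U \<Longrightarrow> (\<lambda>x. f x + g x) \<in> ode_algebra U"
| mult: "f \<in> ode_algebra U \<Longrightarrow> g \<in> ode_algebra U \<Longrightarrow> (\<lambda>x. f x * g x) \<in> ode_algebra U"

lemma one_minus_square_pos: "x \<in> {-1<..<1} \<Longrightarrow> 1 - x\<^sup>2 > (0::real)"
  by (simp add: abs_square_less_1 abs_less_iff)

lemma is_sol_smooth:
  assumes U: "is_sol c1 c2 c3 U"
  shows "smooth_on {-1<..<1} U"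
proof (rule smooth_on_closed_family)
  show "U \<in> ode_algebra U" by (rule ode_algebra.sol)
next
  fix g assume "g \<in> ode_algebra U"
  thus "\<exists>g'\<in>ode_algebra U. \<forall>x\<in>{-1<..<1}. (g has_real_derivative g' x) (at x)"
  proof induction
    case (const c)
    show ?case by (rule bexI[OF _ ode_algebra.const[of 0]]) auto
  next
    case ident
    show ?case by (rule bexI[OF _ ode_algebra.const[of 1]]) auto
  next
    case recip
    have "(\<lambda>x. (2 * x) * ((1 / (1 - x\<^sup>2)) * (1 / (1 - x\<^sup>2)))) \<in> ode_algebra U"
      by (intro ode_algebra.intros)
    moreover have "((\<lambda>x. 1 / (1 - x\<^sup>2)) has_real_derivative (2 * x) * ((1 / (1 - x\<^sup>2)) * (1 / (1 - x\<^sup>2)))) (at x)"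
      if "x \<in> {-1<..<1}" for x :: real
      using one_minus_square_pos[OF that] by (auto intro!: derivative_eq_intros)
    ultimately show ?case by (intro bexI[rotated] ballI)
  next
    case sol
    \<comment> \<open>The ODE solved for U', written with sums and products only so that the
      introduction rules of \<open>ode_algebra\<close> match.\<close>
    let ?D = "\<lambda>x. (c1 * (1 + (- 1) * x) + c2 * (1 + x) + c3 * (1 + (- 1) * (x * x)) + (- 2) * (x * U x)
               + (- 1 / 2) * (U x * U x)) * (1 / (1 - x\<^sup>2))"
    have "?D \<in> ode_algebra U" by (intro ode_algebra.intros)
    moreover have "(U has_real_derivative ?D x) (at x)" if x: "x \<in> {-1<..<1}" for x
    proof -
      obtain D where D: "(U has_real_derivative D) (at x)"
        "(1 - x\<^sup>2) * D + 2 * x * U x + (1/2) * (U x)\<^sup>2 = Pc c1 c2 c3 x"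
        using U x unfolding is_sol_def by blast
      have "D = (Pc c1 c2 c3 x - 2 * x * U x - (1/2) * (U x)\<^sup>2) / (1 - x\<^sup>2)"
        using D(2) one_minus_square_pos[OF x] by (simp add: nonzero_eq_divide_eq mult.commute)
      also have "\<dots> = ?D x" by (simp add: Pc_def power2_eq_square)
      finally show ?thesis using D(1) by simp
    qed
    ultimately show ?case by (intro bexI[rotated] ballI)
  next
    case (add f g)
    from add.IH obtain f' g' where "f' \<in> ode_algebra U" "g' \<in> ode_algebra U"
      "\<forall>x\<in>{-1<..<1}. (f has_real_derivative f' x) (at x)"
      "\<forall>x\<in>{-1<..<1}. (g has_real_derivative g' x) (at x)" by blast
    thus ?case
      by (intro bexI[of _ "\<lambda>x. f' x + g' x"]) (auto intro: ode_algebra.add DERIV_add)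
  next
    case (mult f g)
    from mult.IH obtain f' g' where "f' \<in> ode_algebra U" "g' \<in> ode_algebra U"
      "\<forall>x\<in>{-1<..<1}. (f has_real_derivative f' x) (at x)"
      "\<forall>x\<in>{-1<..<1}. (g has_real_derivative g' x) (at x)" by blast
    thus ?case using mult.hyps
      by (intro bexI[of _ "\<lambda>x. f' x * g x + g' x * f x"] ode_algebra.add ode_algebra.mult)
         (auto intro: DERIV_mult)
  qed
qed auto

section \<open>Passage between U = 2 (1 - x^2) \<phi>'/\<phi> and the Riccati function of w\<close>

definition riccati_lift :: "real \<Rightarrow> real \<Rightarrow> (real \<Rightarrow> real) \<Rightarrow> real \<Rightarrow> real" where
  "riccati_lift \<alpha> \<beta> h x = (1 - x\<^sup>2) * h ((1 + x) / 2) + \<alpha> * (1 - x) - \<beta> * (1 + x)"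

text \<open>The exponents of the linear equation at x = -1 are (1 \<plusminus> sqrt (1 + c1)) / 2, and \<alpha> is twice
  the larger one; \<beta> plays the same role at x = 1, and \<kappa> = (c3 - c3bar c1 c2) / 2.\<close>
definition coupled :: "real \<Rightarrow> real \<Rightarrow> real \<Rightarrow> real \<Rightarrow> real \<Rightarrow> real \<Rightarrow> bool" where
  "coupled c1 c2 c3 \<alpha> \<beta> \<kappa> \<longleftrightarrow> c1 = (\<alpha> - 1)\<^sup>2 - 1 \<and> c2 = (\<beta> - 1)\<^sup>2 - 1 \<and>
     c3 = 2 * \<kappa> - (\<alpha> + \<beta> - 2) * (\<alpha> + \<beta>) / 2"

text \<open>In the lift, \<alpha>(1-x) - \<beta>(1+x) is 2(1-x^2) \<phi>0'/\<phi>0, and the factor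
  following the first 1 - x^2 on the left is the x-derivative of the lift. The defects of the two
  equations thus differ by the factor 2(1-x^2), nonzero on (-1,1), which serves both directions of
  the correspondence.\<close>

lemma ode_riccati_identity:
  fixes x H D :: real
  assumes c: "coupled c1 c2 c3 \<alpha> \<beta> \<kappa>" and t: "x = 2 * t - 1"
    and u: "u = (1 - x\<^sup>2) * H + \<alpha> * (1 - x) - \<beta> * (1 + x)"
  shows "(1 - x\<^sup>2) * ((1 - x\<^sup>2) * D / 2 - 2 * x * H - \<alpha> - \<beta>) + 2 * x * u + (1/2) * u\<^sup>2 - Pc c1 c2 c3 x =
    2 * (1 - x\<^sup>2) * (t * (1 - t) * (D + H\<^sup>2) + (\<alpha> * (1 - t) - \<beta> * t) * H - \<kappa>)"
proof -
  have c': "c1 = (\<alpha> - 1)\<^sup>2 - 1" "c2 = (\<beta> - 1)\<^sup>2 - 1" "c3 = 2 * \<kappa> - (\<alpha> + \<beta> - 2) * (\<alpha> + \<beta>) / 2"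
    using c by (simp_all add: coupled_def)
  show ?thesis unfolding Pc_def t u c' by (simp add: field_simps power2_eq_square)
qed

lemma is_sol_riccati_lift:
  assumes c: "coupled c1 c2 c3 \<alpha> \<beta> \<kappa>" and h: "riccati \<alpha> \<beta> \<kappa> h"
  shows "is_sol c1 c2 c3 (riccati_lift \<alpha> \<beta> h)"
  unfolding is_sol_def
proof
  fix x :: real assume x: "x \<in> {-1<..<1}"
  define t where "t = (1 + x) / 2"
  have t: "t \<in> {0<..<1}" "x = 2 * t - 1" using x by (auto simp: t_def field_simps)
  obtain D where D: "(h has_real_derivative D) (at t)"
    "t * (1 - t) * (D + (h t)\<^sup>2) + (\<alpha> * (1 - t) - \<beta> * t) * h t = \<kappa>"
    using h t unfolding riccati_def by blast
  have "((\<lambda>x. (1 + x) / 2) has_real_derivative 1 / 2) (at x)"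
    by (auto intro!: derivative_eq_intros)
  hence "((\<lambda>x. h ((1 + x) / 2)) has_real_derivative D * (1 / 2)) (at x)"
    using D(1) unfolding t_def by (intro DERIV_chain2[where g = "\<lambda>x. (1 + x) / 2"])
  hence "(riccati_lift \<alpha> \<beta> h has_real_derivative (1 - x\<^sup>2) * D / 2 - 2 * x * h t - \<alpha> - \<beta>) (at x)"
    unfolding riccati_lift_def by (auto intro!: derivative_eq_intros simp: t_def)
  moreover have "(1 - x\<^sup>2) * ((1 - x\<^sup>2) * D / 2 - 2 * x * h t - \<alpha> - \<beta>) + 2 * x * riccati_lift \<alpha> \<beta> h x
      + (1/2) * (riccati_lift \<alpha> \<beta> h x)\<^sup>2 = Pc c1 c2 c3 x"
    using ode_riccati_identity[OF c t(2), of "riccati_lift \<alpha> \<beta> h x" "h t" D] D(2)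
    by (simp add: riccati_lift_def t_def)
  ultimately show "\<exists>D. (riccati_lift \<alpha> \<beta> h has_real_derivative D) (at x) \<and>
      (1 - x\<^sup>2) * D + 2 * x * riccati_lift \<alpha> \<beta> h x + (1/2) * (riccati_lift \<alpha> \<beta> h x)\<^sup>2 = Pc c1 c2 c3 x"
    by blast
qed

lemma is_sol_obtain_riccati:
  assumes c: "coupled c1 c2 c3 \<alpha> \<beta> \<kappa>" and U: "is_sol c1 c2 c3 U"
  obtains h where "riccati \<alpha> \<beta> \<kappa> h" "\<And>x. x \<in> {-1<..<1} \<Longrightarrow> U x = riccati_lift \<alpha> \<beta> h x"
proof
  \<comment> \<open>The lift solved for h, with x = 2t - 1 and hence 1 - x^2 = 4t(1-t).\<close>
  define h where "h t = (U (2 * t - 1) - 2 * \<alpha> * (1 - t) + 2 * \<beta> * t) / (4 * t * (1 - t))" for t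
  show lift: "U x = riccati_lift \<alpha> \<beta> h x" if x: "x \<in> {-1<..<1}" for x
  proof -
    have "h ((1 + x) / 2) = (U x - \<alpha> * (1 - x) + \<beta> * (1 + x)) / (1 - x\<^sup>2)"
    proof -
      have "2 * ((1 + x) / 2) - 1 = x" "2 * \<alpha> * (1 - (1 + x) / 2) = \<alpha> * (1 - x)"
        "2 * \<beta> * ((1 + x) / 2) = \<beta> * (1 + x)" "4 * ((1 + x) / 2) * (1 - (1 + x) / 2) = 1 - x\<^sup>2"
        by (simp_all add: field_simps power2_eq_square)
      thus ?thesis by (simp only: h_def)
    qed
    thus ?thesis using one_minus_square_pos[OF x] by (simp add: riccati_lift_def)
  qed
  show "riccati \<alpha> \<beta> \<kappa> h"
    unfolding riccati_def
  proof
    fix t :: real assume t: "t \<in> {0<..<1}"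
    define x where "x = 2 * t - 1"
    have x: "x \<in> {-1<..<1}" "(1 + x) / 2 = t" using t by (auto simp: x_def)
    have q: "1 - x\<^sup>2 = 4 * t * (1 - t)" by (simp add: x_def algebra_simps power2_eq_square)
    obtain E where E: "(U has_real_derivative E) (at x)"
      "(1 - x\<^sup>2) * E + 2 * x * U x + (1/2) * (U x)\<^sup>2 = Pc c1 c2 c3 x"
      using U x unfolding is_sol_def by blast
    \<comment> \<open>Obtained by solving the formula for the derivative E of the lift for
      D.\<close>
    define D where "D = 2 * (E + \<alpha> + \<beta> + 2 * x * h t) / (1 - x\<^sup>2)"
    have "((\<lambda>t. 2 * t - 1) has_real_derivative 2) (at t)"
      by (auto intro!: derivative_eq_intros)
    hence dU: "((\<lambda>t. U (2 * t - 1)) has_real_derivative E * 2) (at t)"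
      using E(1) unfolding x_def by (intro DERIV_chain2[where g = "\<lambda>t. 2 * t - 1"])
    define N where "N = (\<lambda>t. U (2 * t - 1) - 2 * \<alpha> * (1 - t) + 2 * \<beta> * t)"
    have dN: "(N has_real_derivative 2 * (E + \<alpha> + \<beta>)) (at t)"
      unfolding N_def by (auto intro!: derivative_eq_intros dU)
    have dq: "((\<lambda>t. 4 * t * (1 - t)) has_real_derivative - (4 * x)) (at t)"
      by (auto intro!: derivative_eq_intros simp: x_def algebra_simps)
    have q0: "4 * t * (1 - t) \<noteq> 0" using t by auto
    have hN: "h = (\<lambda>t. N t / (4 * t * (1 - t)))" by (simp add: fun_eq_iff h_def N_def)
    have "(h has_real_derivative (2 * (E + \<alpha> + \<beta>) * (4 * t * (1 - t)) - N t * - (4 * x)) /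
        ((4 * t * (1 - t)) * (4 * t * (1 - t)))) (at t)"
      unfolding hN by (rule DERIV_divide[OF dN dq q0])
    also have "N t = h t * (4 * t * (1 - t))" using q0 by (simp add: hN)
    also have "(2 * (E + \<alpha> + \<beta>) * (4 * t * (1 - t)) - h t * (4 * t * (1 - t)) * - (4 * x)) /
        ((4 * t * (1 - t)) * (4 * t * (1 - t))) =
       ((2 * (E + \<alpha> + \<beta> + 2 * x * h t)) * (4 * t * (1 - t))) / ((4 * t * (1 - t)) * (4 * t * (1 - t)))"
      by (simp only: algebra_simps) simp
    also have "\<dots> = D" unfolding D_def q by (rule mult_divide_mult_cancel_right[OF q0])
    finally have hD: "(h has_real_derivative D) (at t)" .
    have "(1 - x\<^sup>2) * D = 2 * (E + \<alpha> + \<beta> + 2 * x * h t)"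
      using one_minus_square_pos[OF x(1)] by (simp add: D_def)
    hence "E = (1 - x\<^sup>2) * D / 2 - 2 * x * h t - \<alpha> - \<beta>"
      by (simp add: add_divide_distrib)
    hence "2 * (1 - x\<^sup>2) * (t * (1 - t) * (D + (h t)\<^sup>2) + (\<alpha> * (1 - t) - \<beta> * t) * h t - \<kappa>) = 0"
      using ode_riccati_identity[OF c x_def, of "U x" "h t" D] E(2) lift[OF x(1)]
      by (simp add: riccati_lift_def x(2))
    hence "t * (1 - t) * (D + (h t)\<^sup>2) + (\<alpha> * (1 - t) - \<beta> * t) * h t = \<kappa>"
      using one_minus_square_pos[OF x(1)] by simp
    with hD show "\<exists>D. (h has_real_derivative D) (at t) \<and>
       t * (1 - t) * (D + (h t)\<^sup>2) + (\<alpha> * (1 - t) - \<beta> * t) * h t = \<kappa>" by blast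
  qed
qed

lemma is_sol_unique:
  assumes c: "coupled c1 c2 c3 \<alpha> \<beta> \<kappa>" and U: "is_sol c1 c2 c3 U" and V: "is_sol c1 c2 c3 V"
    and eq: "U 0 = V 0" and x: "x \<in> {-1<..<1}"
  shows "U x = V x"
proof -
  obtain h where h: "riccati \<alpha> \<beta> \<kappa> h" "\<And>x. x \<in> {-1<..<1} \<Longrightarrow> U x = riccati_lift \<alpha> \<beta> h x"
    using is_sol_obtain_riccati[OF c U] by blast
  obtain k where k: "riccati \<alpha> \<beta> \<kappa> k" "\<And>x. x \<in> {-1<..<1} \<Longrightarrow> V x = riccati_lift \<alpha> \<beta> k x"
    using is_sol_obtain_riccati[OF c V] by blast
  have "h (1/2) = k (1/2)" using eq h(2)[of 0] k(2)[of 0] by (simp add: riccati_lift_def)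
  hence "h ((1 + x) / 2) = k ((1 + x) / 2)"
    using riccati_unique[OF h(1) k(1), of "1/2" "(1 + x) / 2"] x by simp
  thus ?thesis using h(2)[OF x] k(2)[OF x] by (simp add: riccati_lift_def)
qed

section \<open>Evaluation of the definite descriptions\<close>

lemma gamma_plus_eq:
  assumes "is_sol c1 c2 c3 U" "\<And>V x. is_sol c1 c2 c3 V \<Longrightarrow> x \<in> {-1<..<1} \<Longrightarrow> V x \<le> U x"
  shows "gamma_plus c1 c2 c3 = U 0"
  unfolding gamma_plus_def
proof (rule the_equality)
  fix g assume "\<exists>W. is_sol c1 c2 c3 W \<and> W 0 = g \<and>
    (\<forall>V. is_sol c1 c2 c3 V \<longrightarrow> (\<forall>x\<in>{-1<..<1}. V x \<le> W x))"
  \<comment> \<open>Two maximal solutions bound each other, so their values at 0 agree.\<close>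
  then obtain W where "is_sol c1 c2 c3 W" "W 0 = g" "U 0 \<le> W 0" using assms(1) by fastforce
  thus "g = U 0" using assms(2)[of W 0] by simp
qed (use assms in auto)

lemma gamma_minus_eq:
  assumes "is_sol c1 c2 c3 U" "\<And>V x. is_sol c1 c2 c3 V \<Longrightarrow> x \<in> {-1<..<1} \<Longrightarrow> U x \<le> V x"
  shows "gamma_minus c1 c2 c3 = U 0"
  unfolding gamma_minus_def
proof (rule the_equality)
  fix g assume "\<exists>W. is_sol c1 c2 c3 W \<and> W 0 = g \<and>
    (\<forall>V. is_sol c1 c2 c3 V \<longrightarrow> (\<forall>x\<in>{-1<..<1}. W x \<le> V x))"
  then obtain W where "is_sol c1 c2 c3 W" "W 0 = g" "W 0 \<le> U 0" using assms(1) by fastforce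
  thus "g = U 0" using assms(2)[of W 0] by simp
qed (use assms in auto)

lemma Ucg_eq:
  assumes c: "coupled c1 c2 c3 \<alpha> \<beta> \<kappa>" and U: "is_sol c1 c2 c3 U"
    and l: "(U \<longlongrightarrow> a) (at_right (-1))" and r: "(U \<longlongrightarrow> b) (at_left 1)"
  shows "x \<in> {-1<..<1} \<Longrightarrow> Ucg c1 c2 c3 (U 0) x = U x"
    and "Ucg c1 c2 c3 (U 0) (-1) = a" and "Ucg c1 c2 c3 (U 0) 1 = b"
proof -
  \<comment> \<open>U is extended by its one-sided limits and by 0 outside [-1,1], the convention
    that makes \<open>Ucg\<close> a unique function.\<close>
  define V where "V x = (if x \<in> {-1<..<1} then U x else if x = -1 then a else if x = 1 then b else 0)" for x
  have VU: "V x = U x" if "x \<in> {-1<..<1}" for x using that by (simp add: V_def)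
  have V: "is_sol c1 c2 c3 V"
    unfolding is_sol_def
  proof
    fix x :: real assume x: "x \<in> {-1<..<1}"
    then obtain D where "(U has_real_derivative D) (at x)"
      "(1 - x\<^sup>2) * D + 2 * x * U x + (1/2) * (U x)\<^sup>2 = Pc c1 c2 c3 x"
      using U unfolding is_sol_def by blast
    moreover from this(1) have "(V has_real_derivative D) (at x)"
      by (rule has_field_derivative_transform_within_open[of _ _ _ "{-1<..<1}"]) (use x VU in auto)
    ultimately show "\<exists>D. (V has_real_derivative D) (at x) \<and>
      (1 - x\<^sup>2) * D + 2 * x * V x + (1/2) * (V x)\<^sup>2 = Pc c1 c2 c3 x" using VU[OF x] by auto
  qed
  have evl: "eventually (\<lambda>x. U x = V x) (at_right (-1))" and evr: "eventually (\<lambda>x. U x = V x) (at_left 1)"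
    using eventually_at_right_real[of "-1" 1] eventually_at_left_real[of "-1" 1]
    by (auto elim!: eventually_mono simp: VU)
  have V_ends: "V (-1) = a" "V 1 = b" by (simp_all add: V_def)
  have lim: "(V \<longlongrightarrow> V (-1)) (at_right (-1))" "(V \<longlongrightarrow> V 1) (at_left 1)"
    using Lim_transform_eventually[OF l evl] Lim_transform_eventually[OF r evr] unfolding V_ends .
  have inner: "(V \<longlongrightarrow> V x) (at x)" if "-1 < x" "x < 1" for x
    using V that DERIV_isCont unfolding is_sol_def isCont_def by (meson greaterThanLessThan_iff)
  have cont: "continuous_on {-1..1} V"
    by (rule continuous_on_IccI) (use lim inner in auto)
  have "Ucg c1 c2 c3 (U 0) = V"
    unfolding Ucg_def
  proof (rule the_equality)
    show "is_sol c1 c2 c3 V \<and> smooth_on {-1<..<1} V \<and> continuous_on {-1..1} V \<and> V 0 = U 0 \<and>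
      (\<forall>x. x \<notin> {-1..1} \<longrightarrow> V x = 0)"
      using V is_sol_smooth[OF V] cont VU[of 0] by (auto simp: V_def)
  next
    fix W assume W: "is_sol c1 c2 c3 W \<and> smooth_on {-1<..<1} W \<and> continuous_on {-1..1} W \<and> W 0 = U 0 \<and>
      (\<forall>x. x \<notin> {-1..1} \<longrightarrow> W x = 0)"
    \<comment> \<open>Uniqueness holds on the open interval; continuity carries the equality to the
      endpoints.\<close>
    have "W x - V x = 0" if "x \<in> {-1..1}" for x
    proof (rule continuous_constant_on_closure[of "{-1<..<1}" "\<lambda>x. W x - V x"])
      show "continuous_on (closure {-1<..<1}) (\<lambda>x. W x - V x)"
        using W cont by (auto intro!: continuous_intros)
      show "x \<in> closure {-1<..<1}" using that by simp
      show "W x - V x = 0" if "x \<in> {-1<..<1}" for x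
        using is_sol_unique[OF c _ V _ that, of W] W VU[of 0] by simp
    qed
    thus "W = V" using W by (auto simp: fun_eq_iff V_def)
  qed
  thus "x \<in> {-1<..<1} \<Longrightarrow> Ucg c1 c2 c3 (U 0) x = U x" "Ucg c1 c2 c3 (U 0) (-1) = a"
    "Ucg c1 c2 c3 (U 0) 1 = b"
    using VU by (simp_all add: V_def)
qed

text \<open>With t = (1+x)/2 one has 1 - x^2 = 2(1-x) t, so only the limit of t h(t)
  matters.\<close>

lemma riccati_lift_left_limit:
  assumes "((\<lambda>t. t * h t) \<longlongrightarrow> L) (at_right 0)"
  shows "(riccati_lift \<alpha> \<beta> h \<longlongrightarrow> 4 * L + 2 * \<alpha>) (at_right (-1))"
proof -
  have "filterlim (\<lambda>x::real. (1 + x) / 2) (at_right 0) (at_right (-1))"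
    unfolding filterlim_at by (auto intro!: tendsto_eq_intros simp: eventually_at_filter)
  note lim = filterlim_compose[OF assms this]
  have "((\<lambda>x. 2 * (1 - x) * ((1 + x) / 2 * h ((1 + x) / 2)) + \<alpha> * (1 - x) - \<beta> * (1 + x))
      \<longlongrightarrow> 2 * (1 - - 1) * L + \<alpha> * (1 - - 1) - \<beta> * (1 + - 1)) (at_right (-1))"
    by (intro tendsto_intros lim)
  moreover have "2 * (1 - x) * ((1 + x) / 2 * h ((1 + x) / 2)) = (1 - x\<^sup>2) * h ((1 + x) / 2)" for x
  proof -
    have "2 * (1 - x) * ((1 + x) / 2) = 1 - x\<^sup>2" by (simp add: field_simps power2_eq_square)
    thus ?thesis by (simp only: mult.assoc[symmetric])
  qed
  ultimately show ?thesis
    unfolding riccati_lift_def[abs_def] by (simp only:) (simp add: mult.commute)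
qed

lemma riccati_lift_right_limit:
  assumes "((\<lambda>t. (1 - t) * h t) \<longlongrightarrow> L) (at_left 1)"
  shows "(riccati_lift \<alpha> \<beta> h \<longlongrightarrow> 4 * L - 2 * \<beta>) (at_left 1)"
proof -
  have "filterlim (\<lambda>x::real. (1 + x) / 2) (at_left 1) (at_left 1)"
    unfolding filterlim_at by (auto intro!: tendsto_eq_intros simp: eventually_at_filter)
  note lim = filterlim_compose[OF assms this]
  have "((\<lambda>x. 2 * (1 + x) * ((1 - (1 + x) / 2) * h ((1 + x) / 2)) + \<alpha> * (1 - x) - \<beta> * (1 + x))
      \<longlongrightarrow> 2 * (1 + 1) * L + \<alpha> * (1 - 1) - \<beta> * (1 + 1)) (at_left 1)"
    by (intro tendsto_intros lim)
  moreover have "2 * (1 + x) * ((1 - (1 + x) / 2) * h ((1 + x) / 2)) = (1 - x\<^sup>2) * h ((1 + x) / 2)" for x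
  proof -
    have "2 * (1 + x) * (1 - (1 + x) / 2) = 1 - x\<^sup>2" by (simp add: field_simps power2_eq_square)
    thus ?thesis by (simp only: mult.assoc[symmetric])
  qed
  ultimately show ?thesis
    unfolding riccati_lift_def[abs_def] by (simp only:) (simp add: mult.commute)
qed

section \<open>The family of solutions on (-1,1)\<close>

lemma hyp_coeff_trivial: "hyp_coeff \<alpha> \<beta> 0 (Suc n) = 0"
  by (induction n) auto

text \<open>For \<kappa> = 0 both series are the constant 1. This is the case c3 =
  \<open>c3bar c1 c2\<close>, in which the family collapses to one solution.\<close>

lemma sol_family_trivial: "sol_family \<alpha> \<beta> 0 l t = 0"
proof -
  have "diffs (hyp_coeff a b 0) n = 0" for a b n
    by (simp only: diffs_def hyp_coeff_trivial mult_zero_right)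
  thus ?thesis by (simp add: sol_family_def hyp_deriv_def)
qed

definition U_family :: "real \<Rightarrow> real \<Rightarrow> real \<Rightarrow> real \<Rightarrow> real \<Rightarrow> real" where
  "U_family \<alpha> \<beta> \<kappa> l = riccati_lift \<alpha> \<beta> (sol_family \<alpha> \<beta> \<kappa> l)"

lemma U_family_mono:
  assumes "\<alpha> \<ge> 1" "\<beta> \<ge> 1" "\<kappa> > 0" "x \<in> {-1<..<1}" "0 \<le> l" "l < m" "m \<le> 1"
  shows "U_family \<alpha> \<beta> \<kappa> l x < U_family \<alpha> \<beta> \<kappa> m x"
proof -
  have "sol_family \<alpha> \<beta> \<kappa> l ((1 + x) / 2) < sol_family \<alpha> \<beta> \<kappa> m ((1 + x) / 2)"
    using assms by (intro sol_family_strict_mono) auto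
  thus ?thesis using one_minus_square_pos[OF assms(4)] by (simp add: U_family_def riccati_lift_def)
qed

lemma U_family_bounds:
  assumes c: "coupled c1 c2 c3 \<alpha> \<beta> \<kappa>" and ab: "\<alpha> \<ge> 1" "\<beta> \<ge> 1" "\<kappa> \<ge> 0"
    and V: "is_sol c1 c2 c3 V" and x: "x \<in> {-1<..<1}"
  shows "U_family \<alpha> \<beta> \<kappa> 0 x \<le> V x" "V x \<le> U_family \<alpha> \<beta> \<kappa> 1 x"
proof -
  obtain h where h: "riccati \<alpha> \<beta> \<kappa> h" "\<And>x. x \<in> {-1<..<1} \<Longrightarrow> V x = riccati_lift \<alpha> \<beta> h x"
    using is_sol_obtain_riccati[OF c V] by blast
  show "U_family \<alpha> \<beta> \<kappa> 0 x \<le> V x" "V x \<le> U_family \<alpha> \<beta> \<kappa> 1 x"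
    using riccati_bounds[OF ab h(1), of "(1 + x) / 2"] one_minus_square_pos[OF x] x
    by (simp_all add: h(2)[OF x] U_family_def riccati_lift_def)
qed

lemma U_family_IVT:
  assumes "\<alpha> \<ge> 1" "\<beta> \<ge> 1" "\<kappa> \<ge> 0" and x: "x \<in> {-1<..<1}"
    and "U_family \<alpha> \<beta> \<kappa> 0 x \<le> y" "y \<le> U_family \<alpha> \<beta> \<kappa> 1 x"
  obtains l where "0 \<le> l" "l \<le> 1" "U_family \<alpha> \<beta> \<kappa> l x = y"
proof -
  have "continuous_on {0..1} (\<lambda>l. U_family \<alpha> \<beta> \<kappa> l x)"
    unfolding U_family_def riccati_lift_def
    using x by (intro continuous_intros sol_family_continuous[OF assms(1-3)]) auto
  from IVT'[OF assms(5,6) _ this] show ?thesis using that by auto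
qed

text \<open>The cases refer to the value at 0 because \<gamma> is all that \<open>Ucg\<close> sees.
  For \<kappa> > 0 strict monotonicity lets this value decide whether l is 1 or 0; for \<kappa> = 0
  all l give the same function, so both exceptional cases hold.\<close>

lemma U_family_limits:
  assumes ab: "\<alpha> \<ge> 1" "\<beta> \<ge> 1" "\<kappa> \<ge> 0" and l: "0 \<le> l" "l \<le> 1"
  shows "(U_family \<alpha> \<beta> \<kappa> l \<longlongrightarrow>
      (if U_family \<alpha> \<beta> \<kappa> l 0 = U_family \<alpha> \<beta> \<kappa> 1 0 then 2 * \<alpha> else 4 - 2 * \<alpha>)) (at_right (-1))"
    and "(U_family \<alpha> \<beta> \<kappa> l \<longlongrightarrow>
      (if U_family \<alpha> \<beta> \<kappa> l 0 = U_family \<alpha> \<beta> \<kappa> 0 0 then - 2 * \<beta> else 2 * \<beta> - 4)) (at_left 1)"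
proof -
  note left1 = riccati_lift_left_limit[OF sol_family_left_limit_1[OF ab], of \<alpha> \<beta>, folded U_family_def]
  note right0 = riccati_lift_right_limit[OF sol_family_right_limit_0[OF ab], of \<alpha> \<beta>, folded U_family_def]
  have triv: "U_family \<alpha> \<beta> \<kappa> l = U_family \<alpha> \<beta> \<kappa> m" if "\<kappa> = 0" for m
    by (simp add: U_family_def riccati_lift_def sol_family_trivial that fun_eq_iff)
  show "(U_family \<alpha> \<beta> \<kappa> l \<longlongrightarrow>
      (if U_family \<alpha> \<beta> \<kappa> l 0 = U_family \<alpha> \<beta> \<kappa> 1 0 then 2 * \<alpha> else 4 - 2 * \<alpha>)) (at_right (-1))"
  proof (cases "\<kappa> = 0 \<or> l = 1")
    case True
    hence "U_family \<alpha> \<beta> \<kappa> l = U_family \<alpha> \<beta> \<kappa> 1" using triv by auto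
    thus ?thesis using left1 by simp
  next
    case False
    hence "\<kappa> > 0" "l < 1" using ab l by auto
    moreover from this have "U_family \<alpha> \<beta> \<kappa> l 0 < U_family \<alpha> \<beta> \<kappa> 1 0"
      using ab l by (intro U_family_mono) auto
    ultimately show ?thesis
      using riccati_lift_left_limit[OF sol_family_left_limit[of \<alpha> \<beta> \<kappa> l], of \<alpha> \<beta>] ab l
      by (simp add: U_family_def)
  qed
  show "(U_family \<alpha> \<beta> \<kappa> l \<longlongrightarrow>
      (if U_family \<alpha> \<beta> \<kappa> l 0 = U_family \<alpha> \<beta> \<kappa> 0 0 then - 2 * \<beta> else 2 * \<beta> - 4)) (at_left 1)"
  proof (cases "\<kappa> = 0 \<or> l = 0")
    case True
    hence "U_family \<alpha> \<beta> \<kappa> l = U_family \<alpha> \<beta> \<kappa> 0" using triv by auto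
    thus ?thesis using right0 by simp
  next
    case False
    hence "\<kappa> > 0" "l > 0" using ab l by auto
    moreover from this have "U_family \<alpha> \<beta> \<kappa> 0 0 < U_family \<alpha> \<beta> \<kappa> l 0"
      using ab l by (intro U_family_mono) auto
    ultimately show ?thesis
      using riccati_lift_right_limit[OF sol_family_right_limit[of \<alpha> \<beta> \<kappa> l], of \<alpha> \<beta>] ab l
      by (simp add: U_family_def)
  qed
qed

theorem theorem1p3:
  fixes c1 c2 c3 \<gamma> :: real
  assumes "inI c1 c2 c3 \<gamma>"
  shows "(c3 > c3bar c1 c2 \<longrightarrow>
            gamma_minus c1 c2 c3 < gamma_plus c1 c2 c3 \<and>
            (\<forall>g g'. gamma_minus c1 c2 c3 \<le> g \<and> g < g' \<and> g' \<le> gamma_plus c1 c2 c3 \<longrightarrow>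
               (\<forall>x\<in>{-1<..<1}. Ucg c1 c2 c3 g x < Ucg c1 c2 c3 g' x)) \<and>
            {(x, y). -1 < x \<and> x < 1 \<and> Ucg c1 c2 c3 (gamma_minus c1 c2 c3) x \<le> y \<and>
                     y \<le> Ucg c1 c2 c3 (gamma_plus c1 c2 c3) x}
            = (\<Union>g\<in>{gamma_minus c1 c2 c3 .. gamma_plus c1 c2 c3}.
                 {(x, Ucg c1 c2 c3 g x) | x. -1 < x \<and> x < 1}))
       \<and> Ucg c1 c2 c3 \<gamma> (-1) = (if \<gamma> = gamma_plus c1 c2 c3 then tau2 c1 else tau1 c1)
       \<and> Ucg c1 c2 c3 \<gamma> 1 = (if \<gamma> = gamma_minus c1 c2 c3 then tau1' c2 else tau2' c2)"
proof -
  define \<alpha> \<beta> \<kappa> where "\<alpha> = 1 + sqrt (1 + c1)" "\<beta> = 1 + sqrt (1 + c2)" "\<kappa> = (c3 - c3bar c1 c2) / 2"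
  note defs = this
  define F where "F = U_family \<alpha> \<beta> \<kappa>"
  have J: "c1 \<ge> -1" "c2 \<ge> -1" "c3 \<ge> c3bar c1 c2" using assms by (auto simp: inI_def inJ_def)
  have ab: "\<alpha> \<ge> 1" "\<beta> \<ge> 1" "\<kappa> \<ge> 0" using J by (auto simp: defs)
  have c: "coupled c1 c2 c3 \<alpha> \<beta> \<kappa>"
    using J by (simp add: coupled_def defs c3bar_def field_simps)
  have sol: "is_sol c1 c2 c3 (F l)" if "l \<in> {0..1}" for l
    unfolding F_def U_family_def
    using that by (intro is_sol_riccati_lift[OF c] riccati_sol_family[OF ab]) auto
  note bounds = U_family_bounds[OF c ab, folded F_def]
  have gm: "gamma_minus c1 c2 c3 = F 0 0" using bounds by (intro gamma_minus_eq sol) auto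
  have gp: "gamma_plus c1 c2 c3 = F 1 0" using bounds by (intro gamma_plus_eq sol) auto
  have tau: "tau1 c1 = 4 - 2 * \<alpha>" "tau2 c1 = 2 * \<alpha>" "tau1' c2 = - 2 * \<beta>" "tau2' c2 = 2 * \<beta> - 4"
    by (simp_all add: tau1_def tau2_def tau1'_def tau2'_def defs)
  have U: "x \<in> {-1<..<1} \<Longrightarrow> Ucg c1 c2 c3 (F l 0) x = F l x"
      "Ucg c1 c2 c3 (F l 0) (-1) = (if F l 0 = F 1 0 then tau2 c1 else tau1 c1)"
      "Ucg c1 c2 c3 (F l 0) 1 = (if F l 0 = F 0 0 then tau1' c2 else tau2' c2)"
    if l: "l \<in> {0..1}" for l x
    using Ucg_eq[OF c sol[OF l]] U_family_limits[OF ab, of l, folded F_def] l unfolding tau by auto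
  have surj: "\<exists>l\<in>{0..1}. F l x = y" if "x \<in> {-1<..<1}" "F 0 x \<le> y" "y \<le> F 1 x" for x y
    using U_family_IVT[OF ab, of x y] that unfolding F_def by (metis atLeastAtMost_iff)
  \<comment> \<open>The intermediate value theorem in l, applied at x = 0, provides a parameter for
    \<gamma>.\<close>
  obtain l where l: "l \<in> {0..1}" "\<gamma> = F l 0"
    using surj[of 0 \<gamma>] assms by (auto simp: inI_def gm gp)
  have "F 0 0 < F 1 0 \<and>
    (\<forall>g g'. F 0 0 \<le> g \<and> g < g' \<and> g' \<le> F 1 0 \<longrightarrow> (\<forall>x\<in>{-1<..<1}. Ucg c1 c2 c3 g x < Ucg c1 c2 c3 g' x)) \<and>
    {(x, y). -1 < x \<and> x < 1 \<and> Ucg c1 c2 c3 (F 0 0) x \<le> y \<and> y \<le> Ucg c1 c2 c3 (F 1 0) x}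
      = (\<Union>g\<in>{F 0 0..F 1 0}. {(x, Ucg c1 c2 c3 g x) | x. -1 < x \<and> x < 1})" (is "_ \<and> ?mono \<and> ?L = ?R")
    if "c3 > c3bar c1 c2"
  proof -
    have "\<kappa> > 0" using that by (simp add: defs)
    note mono = U_family_mono[OF ab(1,2) this, folded F_def]
    have "F 0 0 < F 1 0" by (intro mono) auto
    moreover have ?mono
    proof (intro allI impI ballI)
      fix g g' x :: real assume g: "F 0 0 \<le> g \<and> g < g' \<and> g' \<le> F 1 0" and x: "x \<in> {-1<..<1}"
      obtain m where m: "m \<in> {0..1}" "F m 0 = g" using surj[of 0 g] g by auto
      obtain n where n: "n \<in> {0..1}" "F n 0 = g'" using surj[of 0 g'] g by auto
      \<comment> \<open>Strict monotonicity at x = 0 orders the parameters; used once more at x it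
        orders the solutions.\<close>
      have "m < n"
      proof (rule ccontr)
        assume "\<not> m < n"
        hence "F n 0 \<le> F m 0" using mono[of 0 n m] m(1) n(1) by (cases "m = n") auto
        thus False using g m(2) n(2) by simp
      qed
      hence "F m x < F n x" using mono[OF x] m(1) n(1) by auto
      thus "Ucg c1 c2 c3 g x < Ucg c1 c2 c3 g' x"
        using U(1)[OF m(1) x] U(1)[OF n(1) x] m(2) n(2) by simp
    qed
    moreover have "?L = ?R"
    proof (intro subset_antisym subsetI)
      fix p assume "p \<in> ?L"
      then obtain x y where p: "p = (x, y)" and x: "x \<in> {-1<..<1}" and y: "F 0 x \<le> y" "y \<le> F 1 x"
        using U(1) by auto
      \<comment> \<open>The parameter is found at the abscissa x of the given point, and its
        \<gamma> is then read off at 0.\<close>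
      obtain m where m: "m \<in> {0..1}" "F m x = y" using surj[OF x y] by blast
      have "F m 0 \<in> {F 0 0..F 1 0}" using bounds[OF sol[OF m(1)]] by auto
      moreover have "p = (x, Ucg c1 c2 c3 (F m 0) x)" using p m U(1)[OF m(1) x] by simp
      ultimately show "p \<in> ?R" using x by auto
    next
      fix p assume "p \<in> ?R"
      then obtain g x where p: "p = (x, Ucg c1 c2 c3 g x)" and x: "x \<in> {-1<..<1}" and g: "F 0 0 \<le> g" "g \<le> F 1 0"
        by auto
      obtain m where m: "m \<in> {0..1}" "F m 0 = g" using surj[of 0 g] g by auto
      have "F 0 x \<le> F m x" "F m x \<le> F 1 x" using bounds[OF sol[OF m(1)] x] by auto
      thus "p \<in> ?L" using p x U(1)[OF _ x] m by auto
    qed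
    ultimately show ?thesis by blast
  qed
  thus ?thesis unfolding gm gp l(2) using U(2,3)[OF l(1)] by blast
qed

end
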